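(* Let $D\subset\mathbb C^3$ be an open set and let $p\in\partial D$. Assume that $D$ has near $p$ a $\mathcal C^1$ defining function $r$ (with non-zero gradient at $p$) which is twice differentiable at $p$. Let $T_p$ be the complex tangent hyperplane at $p$, and assume that the (real) Hessian of $r$ at $p$ restricted to $T_p$ has two negative eigenvalues and one non-positive eigenvalue; that is, its four real eigenvalues, counted with multiplicity, can be enumerated as $\lambda_1,\lambda_2,\lambda_3,\lambda_4$ with $\lambda_1<0$, $\lambda_2<0$, $\lambda_3\le 0$. If $S(D)\neq\mathbb C^3$, then there exists a complex line $l$ through $p$ such that: (i) $T_p\setminus l\subset D$ near $p$, $l\subset\partial D$ near $p$, and $S(D)\supset\mathbb C^3\setminus l$; (ii) for every point $b\in\mathbb C^3$ with $b\notin l$ or $b=p$, there exists a two-dimensional complex plane $P_b\subset\mathbb C^3$ containing $p$ and $b$ such that $D\cap P_b$ is non-pseudoconvex (so $p\in S(D)$); on the other hand, for every $b\in l$ with $b\ne p$ there is no such plane $P_b$; (iii) in particular, the Hessian of $r$ at $p$ (and hence the Levi form of $r$ at $p$) vanishes along $l$; therefore the Hessian of $r$ at $p$ restricted to $T_p$ has two negative and two zero eigenvalues, and the Levi form of $r$ at $p$ restricted to $T_p$ has one negative and one zero eigenvalue.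
   Context: A two-dimensional plane in $\mathbb C^n$ is a complex affine subspace of complex dimension $2$. For such a plane $P$, $D\cap P$ is regarded as an open subset of $P\cong\mathbb C^2$; the empty set is regarded as pseudoconvex. For an open set $D\subset\mathbb C^n$, $S(D)$ denotes the set of all $a\in\mathbb C^n$ for which there is a two-dimensional plane $P\ni a$ such that $P\cap D$ is non-pseudoconvex. A defining function $r$ of $D$ near $p$ is a real-valued function on a neighborhood $U$ of $p$ with $D\cap U=\{z\in U: r(z)<0\}$, $\partial D\cap U=\{z\in U:r(z)=0\}$. The complex tangent hyperplane $T_p$ is the complex affine hyperplane $\{z\in\mathbb C^3:\sum_{j=1}^3\frac{\partial r}{\partial z_j}(p)(z_j-p_j)=0\}$. Its direction space is a two-dimensional complex (four-dimensional real) vector space, with the inner product induced from $\mathbb C^3$; restricted Hessian (a real quadratic form) and restricted Levi form (a Hermitian form, $X\mapsto\sum_{j,k}\frac{\partial^2 r}{\partial z_j\partial\overline z_k}(p)X_j\overline{X_k}$) are considered on this direction space. A form vanishes along $l$ if the associated quadratic form is zero on every direction vector of $l$. "$A\subset B$ near $p$" means that $A\cap U\subset B$ for some neighborhood $U$ of $p$. *)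

theory Defs
  imports "HOL-Analysis.Analysis" "HOL-Library.Multiset"
begin

section \<open>Pseudoconvexity\<close>

text \<open>Only finite-valued continuous plurisubharmonic functions are needed. For continuous
  functions the inequality below, for all closed discs contained in \<open>D\<close>, is
  subharmonicity along every complex line.\<close>

definition continuous_psh_on :: "(complex^'n) set \<Rightarrow> (complex^'n \<Rightarrow> real) \<Rightarrow> bool" where
  "continuous_psh_on D u \<longleftrightarrow>
     continuous_on D u \<and>
     (\<forall>z w. (\<forall>\<zeta>. cmod \<zeta> \<le> 1 \<longrightarrow> z + \<zeta> *s w \<in> D) \<longrightarrow>
        u z \<le> integral {0..2 * pi} (\<lambda>t. u (z + cis t *s w)) / (2 * pi))"

text \<open>An open set, not necessarily connected, is pseudoconvex if it has a continuous
  plurisubharmonic exhaustion function. The empty set is pseudoconvex.\<close>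

definition pseudoconvex :: "(complex^'n) set \<Rightarrow> bool" where
  "pseudoconvex D \<longleftrightarrow>
     open D \<and> (\<exists>u. continuous_psh_on D u \<and> (\<forall>c. compact {z \<in> D. u z \<le> c}))"


section \<open>Complex planes and sections\<close>

definition complex_affine :: "nat \<Rightarrow> (complex^'n) set \<Rightarrow> bool" where
  "complex_affine d P \<longleftrightarrow> (\<exists>a V. vec.subspace V \<and> vec.dim V = d \<and> P = (\<lambda>x. a + x) ` V)"

abbreviation complex_line :: "(complex^'n) set \<Rightarrow> bool" where
  "complex_line \<equiv> complex_affine 1"

abbreviation complex_plane :: "(complex^'n) set \<Rightarrow> bool" where
  "complex_plane \<equiv> complex_affine 2"

text \<open>A plane \<open>P\<close> is identified with \<open>complex^2\<close> by the affine isomorphisms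
  \<open>w \<mapsto> a + M *v w\<close>. Pseudoconvexity is invariant under complex affine automorphisms of
  \<open>complex^2\<close>, so all such charts give the same answer.\<close>

definition pseudoconvex_in :: "(complex^'n) set \<Rightarrow> (complex^'n) set \<Rightarrow> bool" where
  "pseudoconvex_in P W \<longleftrightarrow>
     (\<forall>a (M :: complex^2^'n). inj ((*v) M) \<and> range (\<lambda>w. a + M *v w) = P \<longrightarrow>
        pseudoconvex {w. a + M *v w \<in> W})"

definition nonpsc_section_set :: "(complex^'n) set \<Rightarrow> (complex^'n) set" where
  "nonpsc_section_set D =
     {a. \<exists>P. complex_plane P \<and> a \<in> P \<and> \<not> pseudoconvex_in P (P \<inter> D)}"

definition subset_near :: "'a::topological_space \<Rightarrow> 'a set \<Rightarrow> 'a set \<Rightarrow> bool" where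
  "subset_near p A B \<longleftrightarrow> (\<exists>U. open U \<and> p \<in> U \<and> A \<inter> U \<subseteq> B)"


section \<open>Defining functions and their derivatives\<close>

definition C1_on :: "('a::euclidean_space) set \<Rightarrow> ('a \<Rightarrow> real) \<Rightarrow> bool" where
  "C1_on U r \<longleftrightarrow>
     (\<forall>z\<in>U. r differentiable (at z)) \<and>
     (\<forall>X. continuous_on U (\<lambda>z. frechet_derivative r (at z) X))"

text \<open>In finite dimension, differentiability at \<open>p\<close> of the derivative map is the same as
  differentiability at \<open>p\<close> of its values at each fixed vector.\<close>

definition twice_differentiable_at :: "('a::euclidean_space \<Rightarrow> real) \<Rightarrow> 'a \<Rightarrow> bool" where
  "twice_differentiable_at r p \<longleftrightarrow>
     (\<forall>\<^sub>F z in nhds p. r differentiable (at z)) \<and>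
     (\<forall>X. (\<lambda>z. frechet_derivative r (at z) X) differentiable (at p))"

definition defining_function ::
    "('a::euclidean_space) set \<Rightarrow> 'a \<Rightarrow> 'a set \<Rightarrow> ('a \<Rightarrow> real) \<Rightarrow> bool" where
  "defining_function D p U r \<longleftrightarrow>
     open U \<and> p \<in> U \<and> D \<inter> U = {z \<in> U. r z < 0} \<and> frontier D \<inter> U = {z \<in> U. r z = 0}"

definition hessian :: "('a::euclidean_space \<Rightarrow> real) \<Rightarrow> 'a \<Rightarrow> 'a \<Rightarrow> 'a \<Rightarrow> real" where
  "hessian r p X Y =
     frechet_derivative (\<lambda>z. frechet_derivative r (at z) X) (at p) Y"

text \<open>The Wirtinger derivatives \<open>\<partial>/\<partial>z\<^sub>j = (\<partial>/\<partial>x\<^sub>j - \<i> \<partial>/\<partial>y\<^sub>j)/2\<close> and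
  \<open>\<partial>/\<partial>cnj z\<^sub>j = (\<partial>/\<partial>x\<^sub>j + \<i> \<partial>/\<partial>y\<^sub>j)/2\<close>.\<close>

definition dz :: "'n \<Rightarrow> (complex^'n \<Rightarrow> complex) \<Rightarrow> complex^'n \<Rightarrow> complex" where
  "dz j f p = (frechet_derivative f (at p) (axis j 1)
                - \<i> * frechet_derivative f (at p) (axis j \<i>)) / 2"

definition dzbar :: "'n \<Rightarrow> (complex^'n \<Rightarrow> complex) \<Rightarrow> complex^'n \<Rightarrow> complex" where
  "dzbar j f p = (frechet_derivative f (at p) (axis j 1)
                   + \<i> * frechet_derivative f (at p) (axis j \<i>)) / 2"

definition levi_form ::
    "(complex^'n \<Rightarrow> real) \<Rightarrow> complex^'n \<Rightarrow> complex^'n \<Rightarrow> complex^'n \<Rightarrow> complex" where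
  "levi_form r p X Y =
     (\<Sum>j\<in>UNIV. \<Sum>k\<in>UNIV. dz j (dzbar k (\<lambda>z. of_real (r z))) p * X $ j * cnj (Y $ k))"

definition tangent_directions ::
    "(complex^'n \<Rightarrow> real) \<Rightarrow> complex^'n \<Rightarrow> (complex^'n) set" where
  "tangent_directions r p = {X. (\<Sum>j\<in>UNIV. dz j (\<lambda>z. of_real (r z)) p * X $ j) = 0}"

definition tangent_hyperplane ::
    "(complex^'n \<Rightarrow> real) \<Rightarrow> complex^'n \<Rightarrow> (complex^'n) set" where
  "tangent_hyperplane r p =
     {z. (\<Sum>j\<in>UNIV. dz j (\<lambda>z. of_real (r z)) p * (z $ j - p $ j)) = 0}"


section \<open>Eigenvalues of restricted forms\<close>

text \<open>The eigenvalues of a symmetric bilinear (respectively Hermitian) form \<open>B\<close> on a subspace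
  \<open>V\<close> are those of the self-adjoint operator of \<open>V\<close> which represents \<open>B\<close> with respect to the
  inner product induced on \<open>V\<close>. The multiset \<open>M\<close> records them with multiplicities, real
  dimensions of eigenspaces in the first case and complex dimensions in the second.\<close>

definition eigenvalues_on ::
    "('a::euclidean_space) set \<Rightarrow> ('a \<Rightarrow> 'a \<Rightarrow> real) \<Rightarrow> real multiset \<Rightarrow> bool" where
  "eigenvalues_on V B M \<longleftrightarrow>
     (\<forall>\<mu>. count M \<mu> = dim {X \<in> V. \<forall>Y\<in>V. B X Y = \<mu> * (X \<bullet> Y)})"

definition hermitian_eigenvalues_on ::
    "(complex^'n) set \<Rightarrow> (complex^'n \<Rightarrow> complex^'n \<Rightarrow> complex) \<Rightarrow> real multiset \<Rightarrow> bool" where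
  "hermitian_eigenvalues_on V B M \<longleftrightarrow>
     (\<forall>\<mu>. count M \<mu> =
        vec.dim {X \<in> V. \<forall>Y\<in>V. B X Y = of_real \<mu> * (\<Sum>j\<in>UNIV. X $ j * cnj (Y $ j))})"

end

theory Submission
  imports Defs
begin

text \<open>
  The eigenvalue hypothesis yields a vector \<open>V\<close> tangent to the boundary such that the Hessian is
  negative definite on the complex line \<open>\<complex>V\<close>. Small discs in the direction \<open>V\<close> then touch the
  boundary at \<open>p\<close> from inside, and by the continuity principle for affine discs every plane through
  \<open>p\<close> that contains \<open>V\<close> and is transverse to \<open>T\<^sub>p\<close> has a non-pseudoconvex section.

  Let \<open>a \<notin> S(D)\<close>. Then \<open>A = a - p\<close> is tangent and independent of \<open>V\<close>. Let \<open>N\<close> be an outward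
  normal vector. All sections by the planes \<open>a + \<complex>(A + \<epsilon>N) + \<complex>(V + \<mu>N)\<close> are
  pseudoconvex, so whether the disc of radius \<open>\<delta>\<close> in the direction \<open>V + \<mu>N\<close> over the point with
  \<open>A\<close>-coordinate \<open>t\<close> lies in \<open>D\<close> does not depend on small \<open>t\<close>, and at \<open>t = 0\<close> the second-order
  expansion of \<open>r\<close> decides it. Taking \<open>\<mu> = 0\<close> and \<open>\<epsilon> \<rightarrow> 0+\<close> gives \<open>r \<le> 0\<close> on \<open>T\<^sub>p\<close> near \<open>p\<close>;
  \<open>\<mu> = \<epsilon> = 0\<close> gives a zero of \<open>r\<close> on each disc; and a plane tilted towards a zero off the line
  \<open>l = p + \<complex>A\<close> would have its disc over \<open>0\<close> in \<open>D\<close> but not the one over that zero. So the zero set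
  of \<open>r\<close> on \<open>T\<^sub>p\<close> is \<open>l\<close>, and everything else follows because the Hessian is non-positive on \<open>T\<^sub>p\<close>
  and vanishes on \<open>l\<close>. If \<open>b \<in> l\<close> and \<open>b \<noteq> p\<close>, then a plane through \<open>p\<close> and \<open>b\<close> contains \<open>a\<close>.
\<close>

section \<open>Discs in pseudoconvex sections\<close>

text \<open>The nonnegative continuous function \<open>m - f\<close> has integral at most 0, so it
  vanishes. This is the equality case of the sub-mean value inequality.\<close>

lemma continuous_le_integral_eq:
  fixes f :: "real \<Rightarrow> real"
  assumes "a < b" "continuous_on {a..b} f" "\<And>x. x \<in> {a..b} \<Longrightarrow> f x \<le> m"
    and "m * (b - a) \<le> integral {a..b} f" and "x \<in> {a..b}"
  shows "f x = m"
proof -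
  have c: "continuous_on {a..b} (\<lambda>x. m - f x)"
    using assms(2) by (intro continuous_intros)
  have i: "integral {a..b} (\<lambda>x. m - f x) = m * (b - a) - integral {a..b} f"
    using assms(1,2) by (subst integral_diff) (auto intro: integrable_continuous_real)
  have "integral {a..b} (\<lambda>x. m - f x) = 0"
    using assms(3,4) i integral_nonneg[OF integrable_continuous_real[OF c]] by fastforce
  then show ?thesis
    using integral_eq_0_iff[OF c assms(1)] assms(3,5) by force
qed

text \<open>Maximum principle. Among the maximum points on the closed unit disc one of largest
  modulus is chosen, so that a single application of the sub-mean value inequality forces it onto
  the unit circle.\<close>

lemma continuous_psh_on_disc_max:
  assumes u: "continuous_psh_on D u" and disc: "\<And>\<zeta>. cmod \<zeta> \<le> 1 \<Longrightarrow> z + \<zeta> *s w \<in> D"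
    and bound: "\<And>\<zeta>. cmod \<zeta> = 1 \<Longrightarrow> u (z + \<zeta> *s w) \<le> c" and "cmod \<xi> \<le> 1"
  shows "u (z + \<xi> *s w) \<le> c"
proof -
  define g where "g \<zeta> = u (z + \<zeta> *s w)" for \<zeta>
  have lin: "continuous_on S (\<lambda>\<zeta>. z + \<zeta> *s w)" for S
    unfolding vector_scalar_mult_def by (intro continuous_intros)
  have g: "continuous_on (cball 0 1) g"
    unfolding g_def using u disc unfolding continuous_psh_on_def
    by (auto intro!: continuous_on_compose2[OF _ lin])
  obtain \<zeta>1 where z1: "\<zeta>1 \<in> cball 0 1" "\<And>\<zeta>. \<zeta> \<in> cball 0 1 \<Longrightarrow> g \<zeta> \<le> g \<zeta>1"
    using continuous_attains_sup[OF compact_cball _ g] by auto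
  define K where "K = {\<zeta> \<in> cball 0 1. g \<zeta> = g \<zeta>1}"
  have "closed K" unfolding K_def
    using continuous_closed_preimage[OF g closed_cball closed_singleton, of "g \<zeta>1"]
    by (simp add: vimage_def Int_def)
  then have "compact K"
    using compact_Int_closed[OF compact_cball, of K 0 1] by (simp add: K_def Int_def)
  moreover have "\<zeta>1 \<in> K" using z1 by (simp add: K_def)
  ultimately obtain \<zeta>0 where z0: "\<zeta>0 \<in> K" "\<And>\<zeta>. \<zeta> \<in> K \<Longrightarrow> cmod \<zeta> \<le> cmod \<zeta>0"
    using continuous_attains_sup[of K cmod] by (auto intro: continuous_intros)
  have le1: "cmod \<zeta>0 \<le> 1" using z0 by (auto simp: K_def)
  \<comment> \<open>otherwise the largest disc around \<open>\<zeta>0\<close> in the unit disc would give a maximum point of larger modulus\<close>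
  have "cmod \<zeta>0 = 1"
  proof (rule ccontr)
    assume "cmod \<zeta>0 \<noteq> 1"
    then have lt: "cmod \<zeta>0 < 1" using le1 by simp
    define \<rho> where "\<rho> = 1 - cmod \<zeta>0"
    have rho: "\<rho> > 0" "\<rho> \<le> 1" using lt by (auto simp: \<rho>_def)
    have inb: "\<zeta>0 + \<rho> * \<zeta> \<in> cball 0 1" if "cmod \<zeta> \<le> 1" for \<zeta> :: complex
    proof -
      have "cmod (\<zeta>0 + \<rho> * \<zeta>) \<le> cmod \<zeta>0 + \<rho> * cmod \<zeta>"
        using norm_triangle_ineq[of \<zeta>0 "\<rho> * \<zeta>"] rho by (simp add: norm_mult)
      also have "\<dots> \<le> cmod \<zeta>0 + \<rho> * 1" using that rho by (intro add_left_mono mult_left_mono) auto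
      finally show ?thesis by (simp add: \<rho>_def)
    qed
    have eq: "z + \<zeta>0 *s w + \<zeta> *s (\<rho> *s w) = z + (\<zeta>0 + \<rho> * \<zeta>) *s w" for \<zeta> :: complex
      by (simp add: vec_eq_iff algebra_simps)
    have sm: "g \<zeta>0 \<le> integral {0..2*pi} (\<lambda>t. g (\<zeta>0 + \<rho> * cis t)) / (2 * pi)"
    proof -
      have "z + \<zeta>0 *s w + \<zeta> *s (complex_of_real \<rho> *s w) \<in> D" if "cmod \<zeta> \<le> 1" for \<zeta>
        unfolding eq using inb[OF that] by (intro disc) simp
      then have "u (z + \<zeta>0 *s w) \<le>
          integral {0..2 * pi} (\<lambda>t. u (z + \<zeta>0 *s w + cis t *s (complex_of_real \<rho> *s w))) / (2 * pi)"
        using u unfolding continuous_psh_on_def by blast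
      then show ?thesis unfolding eq g_def .
    qed
    have cont: "continuous_on {0..2*pi} (\<lambda>t. g (\<zeta>0 + \<rho> * cis t))"
      using inb by (intro continuous_on_compose2[OF g] continuous_intros) auto
    have const: "g (\<zeta>0 + \<rho> * cis t) = g \<zeta>1" if "t \<in> {0..2*pi}" for t
    proof (rule continuous_le_integral_eq[OF _ cont _ _ that])
      show "g (\<zeta>0 + \<rho> * cis x) \<le> g \<zeta>1" for x using inb z1(2) by auto
      show "g \<zeta>1 * (2*pi - 0) \<le> integral {0..2*pi} (\<lambda>t. g (\<zeta>0 + \<rho> * cis t))"
        using sm z0(1) by (simp add: K_def field_simps)
    qed simp
    \<comment> \<open>\<open>cis t\<close> is a point where the circle of radius
      \<open>\<rho>\<close> about \<open>\<zeta>0\<close> touches the unit circle.\<close>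
    obtain t where t: "t \<in> {0..2*pi}" "\<zeta>0 = cmod \<zeta>0 * cis t"
    proof -
      obtain s where s: "0 \<le> s" "s < 2*pi" "\<zeta>0 = cmod \<zeta>0 * cis s"
        using Arg2pi[of \<zeta>0] unfolding is_Arg_def cis_conv_exp by blast
      have "s \<in> {0..2*pi}" using s(1,2) by simp
      then show ?thesis using that s(3) by blast
    qed
    have "\<zeta>0 + \<rho> * cis t = cmod \<zeta>0 * cis t + \<rho> * cis t"
      by (rule arg_cong[OF t(2)])
    also have "\<dots> = cis t" by (simp add: \<rho>_def algebra_simps)
    finally have "cmod (\<zeta>0 + \<rho> * cis t) = 1" by simp
    then show False
      using const[OF t(1)] z0(2)[of "\<zeta>0 + \<rho> * cis t"] inb[of "cis t"] lt by (simp add: K_def)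
  qed
  then have "g \<zeta>1 \<le> c" using bound[of \<zeta>0] z0(1) by (auto simp: K_def g_def)
  then show ?thesis using z1(2)[of \<xi>] assms(4) by (simp add: g_def)
qed

text \<open>Continuity principle for affine discs: the parameters whose closed disc lies in
  \<open>G\<close> form an open and closed subset of \<open>S\<close>. Openness is the tube lemma.
  For closedness, the exhaustion \<open>u\<close> is bounded by some \<open>c\<close> on the circles
  along a convergent sequence of parameters, hence on the discs by the maximum principle; as the
  sublevel set is compact, the limit disc stays in \<open>G\<close>.\<close>

lemma pseudoconvex_disc_propagation:
  fixes G :: "(complex^'n) set"
  assumes G: "pseudoconvex G" and S: "connected S" and "\<delta> \<ge> 0"
    and circ: "\<And>t \<zeta>. t \<in> S \<Longrightarrow> cmod \<zeta> = \<delta> \<Longrightarrow> q + t *s A + \<zeta> *s V \<in> G"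
    and t0: "t0 \<in> S" "\<And>\<zeta>. cmod \<zeta> \<le> \<delta> \<Longrightarrow> q + t0 *s A + \<zeta> *s V \<in> G"
    and "t \<in> S" "cmod \<zeta> \<le> \<delta>"
  shows "q + t *s A + \<zeta> *s V \<in> G"
proof -
  define F where "F = (\<lambda>(t,\<zeta>). q + t *s A + \<zeta> *s V)"
  have cF: "continuous_on X F" for X
    unfolding F_def vector_scalar_mult_def split_def by (intro continuous_intros)
  obtain u where u: "continuous_psh_on G u" "\<And>c. compact {z \<in> G. u z \<le> c}" and oG: "open G"
    using G by (auto simp: pseudoconvex_def)
  define O1 where "O1 = {t \<in> S. \<forall>\<zeta>\<in>cball 0 \<delta>. F (t,\<zeta>) \<in> G}"
  have op: "openin (top_of_set S) O1"
  proof (subst openin_contains_ball, safe)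
    fix s assume s: "s \<in> O1"
    have "open (F -` G)" using cF oG continuous_on_open_vimage[OF open_UNIV] by (metis inf_top.right_neutral)
    moreover have "{s} \<times> cball 0 \<delta> \<subseteq> F -` G" using s by (auto simp: O1_def)
    ultimately obtain X0 where X0: "open X0" "s \<in> X0" "X0 \<times> cball 0 \<delta> \<subseteq> F -` G"
      using Elementary_Topology.tube_lemma[OF compact_cball, of "F -` G" s 0 \<delta>] by auto
    then obtain e where "e > 0" "ball s e \<subseteq> X0" using open_contains_ball by blast
    then show "\<exists>e>0. ball s e \<inter> S \<subseteq> O1" using X0 by (intro exI[of _ e]) (auto simp: O1_def)
  qed (auto simp: O1_def)
  have cl: "closedin (top_of_set S) O1"
  proof (subst closedin_limpt, safe)
    fix s assume lim: "s islimpt O1" and sS: "s \<in> S"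
    obtain f where f: "\<And>n::nat. f n \<in> O1" "f \<longlonglongrightarrow> s"
      using lim unfolding islimpt_sequential by blast
    define C where "C = F ` (insert s (range f) \<times> sphere 0 \<delta>)"
    have "compact C" unfolding C_def
      using f(2) by (intro compact_continuous_image[OF cF] compact_Times compact_sphere
          compact_sequence_with_limit)
    moreover have CG: "C \<subseteq> G" unfolding C_def F_def
      using circ sS f(1) by (auto simp: O1_def)
    ultimately have "compact (u ` C)"
      using u(1) unfolding continuous_psh_on_def
      by (intro compact_continuous_image) (auto intro: continuous_on_subset)
    then obtain c where c: "\<And>x. x \<in> C \<Longrightarrow> u x \<le> c"
      using compact_imp_bounded bounded_imp_bdd_above unfolding bdd_above_def by (metis image_eqI)
    have in_sub: "F (f n, \<xi>) \<in> {z \<in> G. u z \<le> c}" if xi: "\<xi> \<in> cball 0 \<delta>" for n \<xi>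
    proof -
      have FG: "F (f n, \<xi>) \<in> G" if "\<xi> \<in> cball 0 \<delta>" for \<xi> using f(1)[of n] that by (auto simp: O1_def)
      \<comment> \<open>Rescaling to the unit disc needs \<open>\<delta> > 0\<close>; a disc of
        radius 0 is its own boundary circle.\<close>
      show ?thesis
      proof (cases "\<delta> = 0")
        case True
        then have "F (f n, \<xi>) \<in> C" using xi by (auto simp: C_def)
        then show ?thesis using c CG by auto
      next
        case False
        then have d: "\<delta> > 0" using assms(3) by simp
        have e: "F (f n, \<delta> * \<eta>) = (q + f n *s A) + \<eta> *s (\<delta> *s V)" for \<eta> :: complex
          by (simp add: F_def vec_eq_iff algebra_simps)
        have "u ((q + f n *s A) + (\<xi> / \<delta>) *s (\<delta> *s V)) \<le> c"
        proof (rule continuous_psh_on_disc_max[OF u(1)])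
          show "cmod (\<xi> / \<delta>) \<le> 1" using xi d by (simp add: norm_divide)
        next
          fix \<eta> assume "cmod \<eta> \<le> 1"
          then show "q + f n *s A + \<eta> *s (\<delta> *s V) \<in> G"
            unfolding e[symmetric] using d by (intro FG) (simp add: norm_mult mult_left_le)
        next
          fix \<eta> assume "cmod \<eta> = 1"
          then show "u (q + f n *s A + \<eta> *s (\<delta> *s V)) \<le> c"
            unfolding e[symmetric] using d by (intro c) (auto simp: C_def norm_mult)
        qed
        then have "u (F (f n, \<delta> * (\<xi> / \<delta>))) \<le> c" by (simp only: e)
        then show ?thesis using d FG[OF xi] by simp
      qed
    qed
    have "F (s, \<xi>) \<in> G" if "\<xi> \<in> cball 0 \<delta>" for \<xi>
    proof -
      have "(\<lambda>n. F (f n, \<xi>)) \<longlonglongrightarrow> F (s, \<xi>)"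
        using cF[of UNIV] f(2)
        by (intro isCont_tendsto_compose[of _ F] tendsto_intros) (auto simp: continuous_on_eq_continuous_at)
      then have "F (s, \<xi>) \<in> {z \<in> G. u z \<le> c}"
        by (rule closed_sequentially[OF compact_imp_closed[OF u(2)] in_sub[OF that]])
      then show ?thesis by simp
    qed
    then show "s \<in> O1" using sS by (auto simp: O1_def)
  qed (auto simp: O1_def)
  have "t0 \<in> O1" using t0 by (auto simp: O1_def F_def)
  then have "O1 = S" using S op cl unfolding connected_clopen by blast
  then have "t \<in> O1" using assms(7) by simp
  then show ?thesis using assms(8) by (auto simp: O1_def F_def)
qed

definition cplane :: "complex^'n \<Rightarrow> complex^'n \<Rightarrow> complex^'n \<Rightarrow> (complex^'n) set" where
  "cplane q A V = {q + t *s A + \<zeta> *s V |t \<zeta>. True}"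

definition cindep :: "complex^'n \<Rightarrow> complex^'n \<Rightarrow> bool" where
  "cindep A V \<longleftrightarrow> (\<forall>t \<zeta>. t *s A + \<zeta> *s V = 0 \<longrightarrow> t = 0 \<and> \<zeta> = 0)"

lemma complex_plane_cplane:
  fixes A V q :: "complex^'n"
  assumes "cindep A V"
  shows "complex_plane (cplane q A V)"
proof -
  have "V \<noteq> 0"
    using assms[unfolded cindep_def, rule_format, of 0 1] by auto
  have nk: "A \<noteq> k *s V" for k
    using assms[unfolded cindep_def, rule_format, of 1 "-k"] by (auto simp: vec_eq_iff)
  then have ne: "A \<noteq> V" "V \<noteq> 0" using nk[of 1] \<open>V \<noteq> 0\<close> by auto
  then have "vec.independent {A, V}"
    using nk by (auto simp: vec.independent_insert vec.span_singleton)
  then have "vec.dim (vec.span {A, V}) = 2"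
    using ne by (simp add: vec.dim_eq_card_independent)
  moreover have "cplane q A V = (\<lambda>x. q + x) ` vec.span {A, V}"
  proof -
    have "x \<in> vec.span {A, V} \<longleftrightarrow> (\<exists>t \<zeta>. x = t *s A + \<zeta> *s V)" for x
    proof -
      have "x - t *s A = \<zeta> *s V \<longleftrightarrow> x = t *s A + \<zeta> *s V" for t \<zeta>
        by (simp add: diff_eq_eq add.commute)
      then show ?thesis by (simp add: vec.span_insert vec.span_singleton image_iff)
    qed
    then have "vec.span {A, V} = {t *s A + \<zeta> *s V |t \<zeta>. True}" by blast
    then show ?thesis by (auto simp: cplane_def add.assoc)
  qed
  ultimately show ?thesis
    unfolding complex_affine_def using vec.subspace_span by blast
qed

text \<open>\<open>pseudoconvex_in\<close> speaks of all affine charts, so it may be applied to the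
  chart whose matrix has the columns \<open>A\<close> and \<open>V\<close>.\<close>

lemma pseudoconvex_in_cplane:
  fixes A V q :: "complex^'n"
  assumes "cindep A V" and "pseudoconvex_in (cplane q A V) W"
  shows "pseudoconvex {w :: complex^2. q + w $ 1 *s A + w $ 2 *s V \<in> W}"
proof -
  define M :: "complex^2^'n" where "M = (\<chi> i j. if j = 1 then A $ i else V $ i)"
  have M: "M *v w = w $ 1 *s A + w $ 2 *s V" for w
    by (simp add: vec_eq_iff M_def matrix_vector_mult_def sum_2 mult.commute)
  have "inj ((*v) M)"
  proof (rule injI)
    fix x y assume "M *v x = M *v y"
    then have "(x $ 1 - y $ 1) *s A + (x $ 2 - y $ 2) *s V = 0"
      unfolding M by (simp add: vec_eq_iff algebra_simps)
    then have "x $ 1 - y $ 1 = 0 \<and> x $ 2 - y $ 2 = 0"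
      using assms(1) unfolding cindep_def by blast
    then show "x = y" unfolding vec_eq_iff forall_2 by simp
  qed
  moreover have "range (\<lambda>w. q + M *v w) = cplane q A V"
  proof -
    have "\<exists>w. q + t *s A + \<zeta> *s V = q + M *v w" for t \<zeta>
      by (intro exI[of _ "vector [t, \<zeta>]"]) (simp add: M add.assoc)
    then have "cplane q A V \<subseteq> range (\<lambda>w. q + M *v w)"
      unfolding cplane_def by blast
    moreover have "range (\<lambda>w. q + M *v w) \<subseteq> cplane q A V"
      by (auto simp: cplane_def M add.assoc)
    ultimately show ?thesis by blast
  qed
  ultimately have "pseudoconvex {w. q + M *v w \<in> W}"
    using assms(2) unfolding pseudoconvex_in_def by blast
  then show ?thesis by (simp add: M add.assoc)
qed

text \<open>The continuity principle is applied in the chart of the plane, where \<open>A\<close>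
  and \<open>V\<close> become the coordinate vectors.\<close>

lemma cplane_disc_propagation:
  assumes "cindep A V" and psc: "pseudoconvex_in (cplane q A V) (cplane q A V \<inter> D)"
    and S: "connected S" and "\<delta> \<ge> 0"
    and circ: "\<And>t \<zeta>. t \<in> S \<Longrightarrow> cmod \<zeta> = \<delta> \<Longrightarrow> q + t *s A + \<zeta> *s V \<in> D"
    and t0: "t0 \<in> S" "\<And>\<zeta>. cmod \<zeta> \<le> \<delta> \<Longrightarrow> q + t0 *s A + \<zeta> *s V \<in> D"
    and "t \<in> S" "cmod \<zeta> \<le> \<delta>"
  shows "q + t *s A + \<zeta> *s V \<in> D"
proof -
  let ?G = "{w :: complex^2. q + w $ 1 *s A + w $ 2 *s V \<in> cplane q A V \<inter> D}"
  have "0 + t *s axis 1 1 + \<zeta> *s axis 2 1 \<in> ?G \<longleftrightarrow> q + t *s A + \<zeta> *s V \<in> D" for t \<zeta>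
    by (auto simp: axis_def cplane_def)
  then show ?thesis
    using pseudoconvex_disc_propagation[OF pseudoconvex_in_cplane[OF assms(1) psc] S assms(4),
        of 0 "axis 1 1" "axis 2 1" t0 t \<zeta>] assms(5-)
    by blast
qed


section \<open>Second-order expansion at a point\<close>

lemma hessian_has_derivative:
  assumes "twice_differentiable_at r p"
  shows "((\<lambda>z. frechet_derivative r (at z) X) has_derivative hessian r p X) (at p)"
  using assms unfolding twice_differentiable_at_def hessian_def frechet_derivative_works by simp

lemma linear_hessian_right: "twice_differentiable_at r p \<Longrightarrow> linear (hessian r p X)"
  using hessian_has_derivative has_derivative_linear by blast

lemma linear_frechet_derivative_real:
  assumes "r differentiable (at z)"
  shows "linear (frechet_derivative r (at z))"
  using assms frechet_derivative_works has_derivative_linear by blast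

text \<open>Differentiability near \<open>p\<close> makes the first derivative linear in
  \<open>X\<close> at all points close to \<open>p\<close>. These identities can be differentiated
  at \<open>p\<close>, because a derivative is unique and depends only on values near the
  point.\<close>

lemma linear_hessian_left:
  fixes r :: "'a::euclidean_space \<Rightarrow> real"
  assumes r: "twice_differentiable_at r p"
  shows "linear (\<lambda>X. hessian r p X Y)"
proof -
  let ?d = "\<lambda>X z. frechet_derivative r (at z) X"
  have ev: "\<forall>\<^sub>F z in nhds p. linear (frechet_derivative r (at z))"
    using r unfolding twice_differentiable_at_def
    by (auto elim!: eventually_mono intro: linear_frechet_derivative_real)
  have uniq: "hessian r p Z = f'"
    if "(g has_derivative f') (at p)" and "\<forall>\<^sub>F z in nhds p. ?d Z z = g z" for Z g f'
  proof -
    have "(?d Z has_derivative f') (at p)"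
      using that by (intro has_derivative_transform_eventually[OF that(1)])
        (auto simp: eventually_at_filter eq_commute elim: eventually_mono dest: eventually_nhds_x_imp_x)
    then show ?thesis using has_derivative_unique[OF hessian_has_derivative[OF r]] by metis
  qed
  show ?thesis
  proof (rule linearI)
    fix X X'
    have "hessian r p (X + X') = (\<lambda>Y. hessian r p X Y + hessian r p X' Y)"
      by (rule uniq[OF has_derivative_add[OF hessian_has_derivative[OF r] hessian_has_derivative[OF r]]])
         (auto intro: eventually_mono[OF ev] simp: linear_add)
    then show "hessian r p (X + X') Y = hessian r p X Y + hessian r p X' Y" by simp
  next
    fix c X
    have "hessian r p (c *\<^sub>R X) = (\<lambda>Y. c *\<^sub>R hessian r p X Y)"
      by (rule uniq[OF has_derivative_scaleR_right[OF hessian_has_derivative[OF r]]])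
         (auto intro: eventually_mono[OF ev] simp: linear_cmul)
    then show "hessian r p (c *\<^sub>R X) Y = c *\<^sub>R hessian r p X Y" by simp
  qed
qed

lemma bilinear_hessian:
  fixes r :: "'a::euclidean_space \<Rightarrow> real"
  shows "twice_differentiable_at r p \<Longrightarrow> bilinear (hessian r p)"
  unfolding bilinear_def by (blast intro: linear_hessian_left linear_hessian_right)

text \<open>Differentiability of the first derivative is given for one vector at a time. It becomes
  uniform in \<open>X\<close> by taking the estimate for the finitely many basis vectors with
  \<open>e / DIM('a)\<close> and using the smallest radius.\<close>

lemma hessian_remainder:
  fixes r :: "'a::euclidean_space \<Rightarrow> real"
  assumes r: "twice_differentiable_at r p" and "e > 0"
  obtains d where "d > 0" "\<And>h. norm h < d \<Longrightarrow> r differentiable (at (p + h))"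
    "\<And>h X. norm h < d \<Longrightarrow> \<bar>frechet_derivative r (at (p + h)) X - frechet_derivative r (at p) X
        - hessian r p X h\<bar> \<le> e * norm h * norm X"
proof -
  let ?d = "\<lambda>z X. frechet_derivative r (at z) X"
  define R where "R h X = ?d (p + h) X - ?d p X - hessian r p X h" for h X
  define e' where "e' = e / DIM('a)"
  have e': "e' > 0" using assms(2) by (simp add: e'_def)
  have "\<exists>d>0. \<forall>h. norm h < d \<longrightarrow> \<bar>R h b\<bar> \<le> e' * norm h" for b
  proof -
    obtain d where "d > 0" "\<And>y. norm (y - p) < d \<Longrightarrow>
        norm (?d y b - ?d p b - hessian r p b (y - p)) \<le> e' * norm (y - p)"
      using hessian_has_derivative[OF r, of b] e' unfolding has_derivative_at_alt by blast
    from this(1) this(2)[of "p + _"] show ?thesis by (intro exI[of _ d]) (auto simp: R_def)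
  qed
  then obtain D where D: "\<And>b. D b > 0" "\<And>b h. norm h < D b \<Longrightarrow> \<bar>R h b\<bar> \<le> e' * norm h"
    by metis
  obtain d0 where d0: "d0 > 0" "\<And>z. dist z p < d0 \<Longrightarrow> r differentiable (at z)"
    using r unfolding twice_differentiable_at_def eventually_nhds_metric by blast
  define d where "d = Min (insert d0 (D ` Basis))"
  have d: "d > 0" "d \<le> d0" "\<And>b. b \<in> Basis \<Longrightarrow> d \<le> D b"
  proof -
    show "d > 0" using D(1) d0 by (simp add: d_def)
  qed (auto simp: d_def simp del: Min_insert intro!: Min_le)
  have diff: "r differentiable (at (p + h))" if "norm h < d" for h
    using that d d0(2)[of "p + h"] by (simp add: dist_norm)
  have "\<bar>R h X\<bar> \<le> e * norm h * norm X" if h: "norm h < d" for h X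
  proof -
    have "linear (R h)"
      unfolding R_def
      using linear_frechet_derivative_real[OF diff[OF h]] linear_frechet_derivative_real[OF diff, of 0]
        d(1) linear_hessian_left[OF r, of h]
      by (auto intro!: linear_compose_sub)
    then have "R h X = (\<Sum>b\<in>Basis. (X \<bullet> b) * R h b)"
      by (subst euclidean_representation[of X, symmetric])
         (simp add: linear_sum linear_cmul del: euclidean_representation)
    then have "\<bar>R h X\<bar> \<le> (\<Sum>b\<in>Basis. \<bar>X \<bullet> b\<bar> * \<bar>R h b\<bar>)"
      by (simp add: abs_mult[symmetric])
    also have "\<dots> \<le> (\<Sum>b\<in>(Basis::'a set). norm X * (e' * norm h))"
      using D(2) d(3) h e' by (intro sum_mono mult_mono) (auto simp: Basis_le_norm intro: less_le_trans)
    also have "\<dots> = e * norm h * norm X" by (simp add: e'_def)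
    finally show ?thesis .
  qed
  then show ?thesis using that[OF d(1) diff] unfolding R_def by blast
qed

lemma has_real_derivative_along_line:
  fixes r :: "'a::euclidean_space \<Rightarrow> real"
  assumes "r differentiable (at (p + t *\<^sub>R X))"
  shows "((\<lambda>t. r (p + t *\<^sub>R X)) has_real_derivative frechet_derivative r (at (p + t *\<^sub>R X)) X) (at t)"
proof -
  let ?d = "frechet_derivative r (at (p + t *\<^sub>R X))"
  have d: "(r has_derivative ?d) (at (p + t *\<^sub>R X))"
    using assms frechet_derivative_works by blast
  have "((\<lambda>t. p + t *\<^sub>R X) has_derivative (\<lambda>s. s *\<^sub>R X)) (at t)"
    by (auto intro!: derivative_eq_intros)
  from has_derivative_compose[OF this d]
  have "((\<lambda>t. r (p + t *\<^sub>R X)) has_derivative (\<lambda>s. ?d (s *\<^sub>R X))) (at t)" .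
  moreover have "(\<lambda>s. ?d (s *\<^sub>R X)) = (*) (?d X)"
    using linear_frechet_derivative_real[OF assms] by (auto simp: linear_cmul)
  ultimately show ?thesis by (simp add: has_field_derivative_def)
qed

text \<open>Second derivatives are given at \<open>p\<close> alone, so the mean value theorem is
  used once, along the segment to \<open>p + h\<close>, and \<open>hessian_remainder\<close>
  controls the first derivative at the intermediate point.\<close>

lemma taylor_hessian:
  fixes r :: "'a::euclidean_space \<Rightarrow> real"
  assumes r: "twice_differentiable_at r p" and "e > 0"
  obtains d where "d > 0" "\<And>h. norm h < d \<Longrightarrow>
    \<bar>r (p + h) - r p - frechet_derivative r (at p) h - hessian r p h h / 2\<bar> \<le> e * (norm h)\<^sup>2"
proof -
  let ?d = "\<lambda>z X. frechet_derivative r (at z) X"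
  obtain d where d: "d > 0" "\<And>h. norm h < d \<Longrightarrow> r differentiable (at (p + h))"
    "\<And>h X. norm h < d \<Longrightarrow> \<bar>?d (p + h) X - ?d p X - hessian r p X h\<bar> \<le> e * norm h * norm X"
    using hessian_remainder[OF assms] by blast
  show ?thesis
  proof (rule that[OF d(1)])
    fix h :: 'a assume h: "norm h < d"
    \<comment> \<open>With the quadratic Taylor polynomial subtracted, the derivative of
      \<open>\<phi>\<close> is exactly the quantity estimated in
      \<open>hessian_remainder\<close>.\<close>
    define \<phi> where "\<phi> t = r (p + t *\<^sub>R h) - t * ?d p h - t\<^sup>2 / 2 * hessian r p h h" for t
    have small: "norm (t *\<^sub>R h) < d" if "0 \<le> t" "t \<le> 1" for t
      using that h mult_left_le_one_le[of "norm h" t] by simp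
    have der: "(\<phi> has_real_derivative ?d (p + t *\<^sub>R h) h - ?d p h - t * hessian r p h h) (at t)"
      if "0 \<le> t" "t \<le> 1" for t
      unfolding \<phi>_def using has_real_derivative_along_line[OF d(2)[OF small[OF that]]]
      by (auto intro!: derivative_eq_intros)
    obtain t where t: "0 < t" "t < 1"
      "\<phi> 1 - \<phi> 0 = (1 - 0) * (?d (p + t *\<^sub>R h) h - ?d p h - t * hessian r p h h)"
      using MVT2[of 0 1 \<phi>, OF _ der] by auto
    have "hessian r p h (t *\<^sub>R h) = t * hessian r p h h"
      using linear_hessian_right[OF r] by (simp add: linear_cmul)
    then have "\<bar>\<phi> 1 - \<phi> 0\<bar> \<le> e * norm (t *\<^sub>R h) * norm h"
      using d(3)[OF small[of t], of h] t by simp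
    also have "\<dots> \<le> e * norm h * norm h"
      using t assms(2) mult_left_le_one_le[of "norm h" t]
      by (intro mult_right_mono mult_left_mono) auto
    finally show "\<bar>r (p + h) - r p - ?d p h - hessian r p h h / 2\<bar> \<le> e * (norm h)\<^sup>2"
      by (simp add: \<phi>_def power2_eq_square algebra_simps)
  qed
qed

text \<open>The expression on the left is symmetric in \<open>X\<close> and \<open>Y\<close>, hence so is the Hessian.\<close>

lemma hessian_second_difference:
  fixes r :: "'a::euclidean_space \<Rightarrow> real"
  assumes r: "twice_differentiable_at r p" and "e > 0"
  obtains d where "d > 0" "\<And>s. 0 < s \<Longrightarrow> s < d \<Longrightarrow>
    \<bar>r (p + s *\<^sub>R X + s *\<^sub>R Y) - r (p + s *\<^sub>R X) - r (p + s *\<^sub>R Y) + r p - s\<^sup>2 * hessian r p X Y\<bar> \<le> e * s\<^sup>2"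
proof -
  let ?d = "\<lambda>z X. frechet_derivative r (at z) X"
  define N where "N = norm X + norm Y + 1"
  \<comment> \<open>The mean value theorem will leave two error terms, taken at points of norm at
    most \<open>s * N\<close>; each gets half of the allowed error.\<close>
  define e' where "e' = e / (2 * N * N)"
  have N: "N > 0" "norm X \<le> N" by (auto simp: N_def add_nonneg_pos)
  then have e': "e' > 0" using assms(2) by (simp add: e'_def)
  obtain d where d: "d > 0" "\<And>h. norm h < d \<Longrightarrow> r differentiable (at (p + h))"
    "\<And>h X. norm h < d \<Longrightarrow> \<bar>?d (p + h) X - ?d p X - hessian r p X h\<bar> \<le> e' * norm h * norm X"
    using hessian_remainder[OF r e'] by blast
  show ?thesis
  proof (rule that[of "d / N"])
    show "d / N > 0" using d N by simp
    fix s assume s: "0 < s" "s < d / N"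
    have small: "norm ((s * t) *\<^sub>R X + c *\<^sub>R Y) \<le> s * N" "norm ((s * t) *\<^sub>R X + c *\<^sub>R Y) < d"
      if "0 \<le> t" "t \<le> 1" "0 \<le> c" "c \<le> s" for t c
    proof -
      have "norm ((s * t) *\<^sub>R X + c *\<^sub>R Y) \<le> s * t * norm X + c * norm Y"
        using that s norm_triangle_ineq[of "(s * t) *\<^sub>R X" "c *\<^sub>R Y"] by simp
      also have "\<dots> \<le> s * 1 * norm X + s * norm Y"
        using that s by (intro add_mono mult_right_mono mult_left_mono) auto
      also have "\<dots> \<le> s * N" using s by (simp add: N_def algebra_simps)
      finally show 1: "norm ((s * t) *\<^sub>R X + c *\<^sub>R Y) \<le> s * N" .
      have "s * N < d" using s N by (simp add: field_simps)
      then show "norm ((s * t) *\<^sub>R X + c *\<^sub>R Y) < d" using 1 by simp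
    qed
    \<comment> \<open>The second difference is \<open>g 1 - g 0\<close>: the increment in direction
      \<open>Y\<close> is followed along \<open>X\<close>. The points \<open>h1\<close> and
      \<open>h2\<close> at which derivatives are then compared differ by
      \<open>s *\<^sub>R Y\<close>, which produces \<open>hessian r p X Y\<close>.\<close>
    define g where "g t = r ((p + s *\<^sub>R Y) + t *\<^sub>R (s *\<^sub>R X)) - r (p + t *\<^sub>R (s *\<^sub>R X))" for t
    define g' where "g' t = ?d (p + ((s * t) *\<^sub>R X + s *\<^sub>R Y)) (s *\<^sub>R X)
        - ?d (p + ((s * t) *\<^sub>R X + 0 *\<^sub>R Y)) (s *\<^sub>R X)" for t
    have der: "(g has_real_derivative g' t) (at t)" if "0 \<le> t" "t \<le> 1" for t
    proof -
      have e1: "p + s *\<^sub>R Y + t *\<^sub>R s *\<^sub>R X = p + ((s * t) *\<^sub>R X + s *\<^sub>R Y)"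
        and e2: "p + t *\<^sub>R s *\<^sub>R X = p + ((s * t) *\<^sub>R X + 0 *\<^sub>R Y)"
        by (simp_all add: algebra_simps)
      have "r differentiable (at (p + s *\<^sub>R Y + t *\<^sub>R s *\<^sub>R X))"
        unfolding e1 using d(2) small(2)[OF that, of s] s by simp
      moreover have "r differentiable (at (p + t *\<^sub>R s *\<^sub>R X))"
        unfolding e2 using d(2) small(2)[OF that, of 0] s by simp
      ultimately show ?thesis unfolding g_def g'_def
        using has_real_derivative_along_line[of r "p + s *\<^sub>R Y" t "s *\<^sub>R X"]
          has_real_derivative_along_line[of r p t "s *\<^sub>R X"]
        by (intro DERIV_diff) (simp_all only: e1 e2)
    qed
    obtain t where t: "0 < t" "t < 1" "g 1 - g 0 = g' t"
      using MVT2[of 0 1 g g', OF _ der] by auto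
    define h1 h2 where "h1 = (s * t) *\<^sub>R X + s *\<^sub>R Y" and "h2 = (s * t) *\<^sub>R X + 0 *\<^sub>R Y"
    have "hessian r p (s *\<^sub>R X) h1 - hessian r p (s *\<^sub>R X) h2 = hessian r p (s *\<^sub>R X) (h1 - h2)"
      using linear_hessian_right[OF r] by (simp add: linear_diff)
    also have "\<dots> = s\<^sup>2 * hessian r p X Y"
      by (simp add: h1_def h2_def linear_cmul[OF linear_hessian_right[OF r]]
          linear_cmul[OF linear_hessian_left[OF r]] power2_eq_square)
    finally have H: "hessian r p (s *\<^sub>R X) h1 - hessian r p (s *\<^sub>R X) h2 = s\<^sup>2 * hessian r p X Y" .
    have n: "norm h1 \<le> s * N" "norm h1 < d" "norm h2 \<le> s * N" "norm h2 < d"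
      using small[of t s] small[of t 0] t s by (auto simp: h1_def h2_def)
    have b: "e' * norm h * norm (s *\<^sub>R X) \<le> e / 2 * s\<^sup>2" if "norm h \<le> s * N" for h :: 'a
    proof -
      have "e' * norm h * norm (s *\<^sub>R X) \<le> e' * (s * N) * (s * N)"
        using that e' s N by (intro mult_mono) auto
      also have "\<dots> = e / 2 * s\<^sup>2" using N by (simp add: e'_def power2_eq_square)
      finally show ?thesis .
    qed
    have "\<bar>g' t - s\<^sup>2 * hessian r p X Y\<bar> \<le> e * s\<^sup>2"
      using d(3)[OF n(2), of "s *\<^sub>R X"] d(3)[OF n(4), of "s *\<^sub>R X"] b[OF n(1)] b[OF n(3)] H
      unfolding g'_def h1_def[symmetric] h2_def[symmetric] by linarith
    moreover have "g 1 - g 0 = r (p + s *\<^sub>R X + s *\<^sub>R Y) - r (p + s *\<^sub>R X) - r (p + s *\<^sub>R Y) + r p"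
      by (simp add: g_def algebra_simps)
    ultimately show "\<bar>r (p + s *\<^sub>R X + s *\<^sub>R Y) - r (p + s *\<^sub>R X) - r (p + s *\<^sub>R Y) + r p
        - s\<^sup>2 * hessian r p X Y\<bar> \<le> e * s\<^sup>2"
      using t(3) by simp
  qed
qed

lemma hessian_commute:
  fixes r :: "'a::euclidean_space \<Rightarrow> real"
  assumes r: "twice_differentiable_at r p"
  shows "hessian r p X Y = hessian r p Y X"
proof -
  have "\<bar>hessian r p X Y - hessian r p Y X\<bar> \<le> e" if "e > 0" for e
  proof -
    have e2: "e / 2 > 0" using that by simp
    obtain d1 where d1: "d1 > 0" "\<And>s. 0 < s \<Longrightarrow> s < d1 \<Longrightarrow>
      \<bar>r (p + s *\<^sub>R X + s *\<^sub>R Y) - r (p + s *\<^sub>R X) - r (p + s *\<^sub>R Y) + r p - s\<^sup>2 * hessian r p X Y\<bar> \<le> e / 2 * s\<^sup>2"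
      using hessian_second_difference[OF r e2] by blast
    obtain d2 where d2: "d2 > 0" "\<And>s. 0 < s \<Longrightarrow> s < d2 \<Longrightarrow>
      \<bar>r (p + s *\<^sub>R Y + s *\<^sub>R X) - r (p + s *\<^sub>R Y) - r (p + s *\<^sub>R X) + r p - s\<^sup>2 * hessian r p Y X\<bar> \<le> e / 2 * s\<^sup>2"
      using hessian_second_difference[OF r e2] by blast
    define s where "s = min d1 d2 / 2"
    have s: "0 < s" "s < d1" "s < d2" using d1 d2 by (auto simp: s_def)
    have comm: "p + s *\<^sub>R Y + s *\<^sub>R X = p + s *\<^sub>R X + s *\<^sub>R Y" by simp
    have "\<bar>s\<^sup>2 * hessian r p X Y - s\<^sup>2 * hessian r p Y X\<bar> \<le> e / 2 * s\<^sup>2 + e / 2 * s\<^sup>2"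
      using d1(2)[OF s(1,2)] d2(2)[OF s(1,3), unfolded comm] by argo
    then have "\<bar>s\<^sup>2 * (hessian r p X Y - hessian r p Y X)\<bar> \<le> s\<^sup>2 * e"
      by (simp add: right_diff_distrib mult.commute)
    then show ?thesis using s by (simp add: abs_mult)
  qed
  from field_le_epsilon[of "\<bar>hessian r p X Y - hessian r p Y X\<bar>" 0, OF this[simplified]] show ?thesis by auto
qed


section \<open>Wirtinger derivatives and the Levi form\<close>

lemma complex_vec_expansion:
  fixes X :: "complex^'n"
  shows "X = (\<Sum>j\<in>UNIV. Re (X $ j) *\<^sub>R axis j 1 + Im (X $ j) *\<^sub>R axis j \<i>)"
proof (subst vec_eq_iff, rule allI)
  fix i
  have "(\<Sum>j\<in>UNIV. Re (X $ j) *\<^sub>R axis j 1 + Im (X $ j) *\<^sub>R axis j \<i>) $ i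
      = (\<Sum>j\<in>UNIV. if j = i then X $ i else 0)"
    by (simp only: sum_component, intro sum.cong refl)
       (auto simp: axis_def complex_eq_iff)
  then show "X $ i = (\<Sum>j\<in>UNIV. Re (X $ j) *\<^sub>R axis j 1 + Im (X $ j) *\<^sub>R axis j \<i>) $ i"
    by simp
qed

lemma linear_complex_vec_expansion:
  fixes f :: "complex^'n \<Rightarrow> 'b::real_vector"
  assumes "linear f"
  shows "f X = (\<Sum>j\<in>UNIV. Re (X $ j) *\<^sub>R f (axis j 1) + Im (X $ j) *\<^sub>R f (axis j \<i>))"
  by (subst complex_vec_expansion[of X]) (simp add: linear_sum linear_add linear_cmul assms)

lemma complex_linear_expansion:
  fixes f :: "complex^'n \<Rightarrow> complex"
  assumes "linear f" and "\<And>X. f (\<i> *s X) = \<i> * f X"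
  shows "f X = (\<Sum>j\<in>UNIV. f (axis j 1) * X $ j)"
proof -
  have "axis j \<i> = \<i> *s (axis j 1 :: complex^'n)" for j by (simp add: vec_eq_iff axis_def)
  then have "f (axis j \<i>) = \<i> * f (axis j 1)" for j by (simp add: assms(2))
  then show ?thesis
    by (subst linear_complex_vec_expansion[OF assms(1)])
       (auto intro!: sum.cong simp: complex_eq_iff algebra_simps)
qed

lemma frechet_derivative_complex_of_real:
  assumes "r differentiable (at z)"
  shows "frechet_derivative (\<lambda>z. complex_of_real (r z)) (at z) = (\<lambda>X. of_real (frechet_derivative r (at z) X))"
proof -
  have "(r has_derivative frechet_derivative r (at z)) (at z)"
    using assms frechet_derivative_works by blast
  then have "((\<lambda>z. complex_of_real (r z)) has_derivative (\<lambda>X. of_real (frechet_derivative r (at z) X))) (at z)"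
    by (rule has_derivative_of_real)
  then show ?thesis by (metis frechet_derivative_at)
qed

lemma i_smult_linear: "linear ((*s) \<i> :: complex^'n \<Rightarrow> complex^'n)"
  by (rule linearI) (auto simp: vec_eq_iff scaleR_conv_of_real algebra_simps)

text \<open>The right-hand side is the complex linear part of the differential, so its coefficients
  are its values at \<open>axis j 1\<close>, and these are the \<open>dz j\<close>. Consequently the
  tangent directions form the largest complex subspace of the kernel of the real
  differential.\<close>

lemma sum_dz:
  fixes r :: "complex^'n \<Rightarrow> real"
  assumes "r differentiable (at p)"
  shows "(\<Sum>j\<in>UNIV. dz j (\<lambda>z. of_real (r z)) p * X $ j) =
    (of_real (frechet_derivative r (at p) X) - \<i> * of_real (frechet_derivative r (at p) (\<i> *s X))) / 2"
proof -
  let ?d = "frechet_derivative r (at p)"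
  let ?f = "\<lambda>X. (of_real (?d X) - \<i> * of_real (?d (\<i> *s X))) / 2"
  have l: "linear ?d" by (rule linear_frechet_derivative_real[OF assms])
  have ii: "\<i> *s (\<i> *s Y) = - Y" for Y :: "complex^'n" by (simp add: vec_eq_iff)
  have "?f X = (\<Sum>j\<in>UNIV. ?f (axis j 1) * X $ j)"
  proof (rule complex_linear_expansion)
    show "linear ?f"
      by (rule linearI)
         (auto simp: l linear_add linear_cmul linear_add[OF i_smult_linear] linear_cmul[OF i_smult_linear]
           complex_eq_iff algebra_simps add_divide_distrib diff_divide_distrib)
    show "?f (\<i> *s Y) = \<i> * ?f Y" for Y
      unfolding ii linear_neg[OF l] by (simp add: complex_eq_iff)
  qed
  moreover have "\<i> *s axis j 1 = (axis j \<i> :: complex^'n)" for j by (simp add: vec_eq_iff axis_def)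
  ultimately show ?thesis
    by (simp add: dz_def frechet_derivative_complex_of_real[OF assms])
qed

lemma tangent_directions_iff:
  assumes "r differentiable (at p)"
  shows "X \<in> tangent_directions r p \<longleftrightarrow>
    frechet_derivative r (at p) X = 0 \<and> frechet_derivative r (at p) (\<i> *s X) = 0"
  unfolding tangent_directions_def mem_Collect_eq sum_dz[OF assms] by (auto simp: complex_eq_iff)

lemma subspace_tangent_directions: "vec.subspace (tangent_directions r p)"
  by (rule vec.subspaceI) (auto simp: tangent_directions_def algebra_simps sum.distrib
      simp flip: sum_distrib_left)

lemma tangent_hyperplane_iff: "z \<in> tangent_hyperplane r p \<longleftrightarrow> z - p \<in> tangent_directions r p"
  by (simp add: tangent_hyperplane_def tangent_directions_def)

text \<open>Both sides are complex linear in \<open>X\<close> and conjugate linear in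
  \<open>Y\<close>, so it suffices to compare them on coordinate vectors. On the diagonal the
  imaginary part cancels by symmetry, and a quarter of the sum of the Hessian at \<open>X\<close>
  and at \<open>\<i> *s X\<close> remains.\<close>

lemma levi_form_eq:
  fixes r :: "complex^'n \<Rightarrow> real"
  assumes r: "twice_differentiable_at r p"
  shows "levi_form r p X Y = (of_real (hessian r p X Y + hessian r p (\<i> *s X) (\<i> *s Y))
     + \<i> * of_real (hessian r p X (\<i> *s Y) - hessian r p (\<i> *s X) Y)) / 4"
proof -
  let ?H = "hessian r p"
  define \<Lambda> where "\<Lambda> X Y = (of_real (?H X Y + ?H (\<i> *s X) (\<i> *s Y))
     + \<i> * of_real (?H X (\<i> *s Y) - ?H (\<i> *s X) Y)) / 4" for X Y
  have bl: "bilinear ?H" by (rule bilinear_hessian[OF r])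
  note H = bilinear_ladd[OF bl] bilinear_radd[OF bl] bilinear_lmul[OF bl] bilinear_rmul[OF bl]
    bilinear_lneg[OF bl] bilinear_rneg[OF bl]
  note I = linear_add[OF i_smult_linear] linear_cmul[OF i_smult_linear]
  have ii: "\<i> *s (\<i> *s Y) = - Y" for Y :: "complex^'n" by (simp add: vec_eq_iff)
  have "\<Lambda> X Y = (\<Sum>j\<in>UNIV. \<Lambda> (axis j 1) Y * X $ j)"
  proof (rule complex_linear_expansion)
    show "linear (\<lambda>X. \<Lambda> X Y)"
      by (rule linearI) (auto simp: \<Lambda>_def H I complex_eq_iff algebra_simps add_divide_distrib diff_divide_distrib)
    show "\<Lambda> (\<i> *s Z) Y = \<i> * \<Lambda> Z Y" for Z
      unfolding \<Lambda>_def ii H by (simp add: complex_eq_iff)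
  qed
  moreover have "cnj (\<Lambda> Z Y) = (\<Sum>k\<in>UNIV. cnj (\<Lambda> Z (axis k 1)) * Y $ k)" for Z
  proof (rule complex_linear_expansion)
    show "linear (\<lambda>Y. cnj (\<Lambda> Z Y))"
      by (rule linearI) (auto simp: \<Lambda>_def H I complex_eq_iff algebra_simps add_divide_distrib diff_divide_distrib)
    show "cnj (\<Lambda> Z (\<i> *s Y)) = \<i> * cnj (\<Lambda> Z Y)" for Y
      unfolding \<Lambda>_def ii H by (simp add: complex_eq_iff)
  qed
  then have "\<Lambda> Z Y = (\<Sum>k\<in>UNIV. \<Lambda> Z (axis k 1) * cnj (Y $ k))" for Z
    by (metis (no_types, lifting) complex_cnj_cnj complex_cnj_mult cnj_sum sum.cong)
  ultimately have L: "\<Lambda> X Y = (\<Sum>j\<in>UNIV. (\<Sum>k\<in>UNIV. \<Lambda> (axis j 1) (axis k 1) * cnj (Y $ k)) * X $ j)"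
    by simp
  \<comment> \<open>The outer derivative \<open>dz j\<close> fills the second argument of the
    Hessian, whereas \<open>\<Lambda>\<close> has \<open>axis j\<close> in the first; symmetry of
    the Hessian reconciles the two.\<close>
  have coeff: "dz j (dzbar k (\<lambda>z. of_real (r z))) p = \<Lambda> (axis j 1) (axis k 1)" for j k
  proof -
    let ?d = "\<lambda>z X. frechet_derivative r (at z) X"
    let ?g = "\<lambda>z. (complex_of_real (?d z (axis k 1)) + \<i> * of_real (?d z (axis k \<i>))) / 2"
    let ?g' = "\<lambda>Y. (complex_of_real (?H (axis k 1) Y) + \<i> * of_real (?H (axis k \<i>) Y)) / 2"
    have ev: "\<forall>\<^sub>F z in nhds p. ?g z = dzbar k (\<lambda>z. of_real (r z)) z"
      using r unfolding twice_differentiable_at_def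
      by (auto elim!: eventually_mono simp: dzbar_def frechet_derivative_complex_of_real)
    have "(?g has_derivative ?g') (at p)"
      by (auto intro!: derivative_eq_intros hessian_has_derivative[OF r])
    then have "(dzbar k (\<lambda>z. of_real (r z)) has_derivative ?g') (at p)"
      by (rule has_derivative_transform_eventually)
         (use ev eventually_nhds_x_imp_x[OF ev] in \<open>auto simp: eventually_at_filter elim: eventually_mono\<close>)
    then have "frechet_derivative (dzbar k (\<lambda>z. of_real (r z))) (at p) = ?g'"
      by (rule frechet_derivative_at[symmetric])
    moreover have "\<i> *s axis j 1 = (axis j \<i> :: complex^'n)" for j by (simp add: vec_eq_iff axis_def)
    ultimately show ?thesis
      by (simp add: dz_def \<Lambda>_def complex_eq_iff hessian_commute[OF r, of "axis k _"])
  qed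
  show ?thesis
    unfolding levi_form_def coeff \<Lambda>_def[symmetric] L
    by (auto simp: sum_distrib_right sum_distrib_left algebra_simps intro!: sum.cong)
qed


section \<open>Eigenvalues of restricted forms\<close>

text \<open>\<open>E\<close> is the union of orthonormal bases of the eigenspaces. Symmetry makes
  eigenspaces of different eigenvalues orthogonal, and a basis vector \<open>x\<close> recovers its
  eigenvalue as \<open>B x x\<close>, so \<open>E\<close> counts the multiplicities.\<close>

lemma eigenvalues_on_orthonormal:
  fixes V :: "'a::euclidean_space set"
  assumes V: "subspace V" and B: "bilinear B" and M: "eigenvalues_on V B M"
    and sym: "\<And>X Y. X \<in> V \<Longrightarrow> Y \<in> V \<Longrightarrow> B X Y = B Y X"
  obtains E where "finite E" "E \<subseteq> V" "pairwise orthogonal E" "\<And>x. x \<in> E \<Longrightarrow> norm x = 1"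
    "image_mset (\<lambda>x. B x x) (mset_set E) = M" "\<And>x Y. x \<in> E \<Longrightarrow> Y \<in> V \<Longrightarrow> B x Y = B x x * (x \<bullet> Y)"
proof -
  define S where "S \<mu> = {X \<in> V. \<forall>Y\<in>V. B X Y = \<mu> * (X \<bullet> Y)}" for \<mu>
  have "subspace (S \<mu>)" for \<mu>
    unfolding S_def using V
    by (auto simp: subspace_def bilinear_lzero[OF B] bilinear_ladd[OF B] bilinear_lmul[OF B]
        inner_add_left algebra_simps)
  then have "\<exists>b. b \<subseteq> S \<mu> \<and> pairwise orthogonal b \<and> (\<forall>x\<in>b. norm x = 1) \<and> card b = dim (S \<mu>) \<and> finite b" for \<mu>
    by (metis orthonormal_basis_subspace pairwise_orthogonal_imp_finite)
  then obtain b where b: "\<And>\<mu>. b \<mu> \<subseteq> S \<mu>" "\<And>\<mu>. pairwise orthogonal (b \<mu>)"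
    "\<And>\<mu> x. x \<in> b \<mu> \<Longrightarrow> norm x = 1" "\<And>\<mu>. card (b \<mu>) = dim (S \<mu>)" "\<And>\<mu>. finite (b \<mu>)"
    by metis
  define E where "E = (\<Union>\<mu>\<in>set_mset M. b \<mu>)"
  have eig: "x \<in> V \<and> B x x = \<mu> \<and> (\<forall>Y\<in>V. B x Y = \<mu> * (x \<bullet> Y))" if "x \<in> b \<mu>" for x \<mu>
    using b(1)[of \<mu>] b(3)[OF that] that by (auto simp: S_def norm_eq_1)
  have fin: "finite E" using b(5) by (simp add: E_def)
  have orth: "orthogonal x y" if xy: "x \<in> b \<mu>" "y \<in> b \<nu>" "x \<noteq> y" for x y \<mu> \<nu>
  proof (cases "\<mu> = \<nu>")
    case True
    then show ?thesis using b(2)[of \<mu>] xy by (auto simp: pairwise_def)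
  next
    case False
    have "\<mu> * (x \<bullet> y) = \<nu> * (x \<bullet> y)"
      using eig[OF xy(1)] eig[OF xy(2)] sym[of x y] by (metis inner_commute)
    then show ?thesis using False by (simp add: orthogonal_def)
  qed
  have "image_mset (\<lambda>x. B x x) (mset_set E) = M"
  proof (rule multiset_eqI)
    fix \<mu>
    have "(\<lambda>x. B x x) -` {\<mu>} \<inter> E = (if \<mu> \<in># M then b \<mu> else {})"
      using eig by (auto simp: E_def)
    moreover have "card (b \<mu>) = count M \<mu>"
      using M b(4)[of \<mu>] by (simp add: eigenvalues_on_def S_def)
    ultimately have "card ((\<lambda>x. B x x) -` {\<mu>} \<inter> E) = count M \<mu>"
      by (auto simp: not_in_iff)
    moreover have "count (image_mset (\<lambda>x. B x x) (mset_set E)) \<mu> = card ((\<lambda>x. B x x) -` {\<mu>} \<inter> E)"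
      using fin by (simp add: count_image_mset)
    ultimately show "count (image_mset (\<lambda>x. B x x) (mset_set E)) \<mu> = count M \<mu>" by simp
  qed
  then show ?thesis
    using eig orth b(3) fin by (intro that[of E]) (auto simp: E_def pairwise_def)
qed

text \<open>The eigenvalues are peeled off the multiset one at a time, which keeps equal ones apart.
  Four orthonormal vectors in a space of dimension at most 4 span it.\<close>

lemma eigenvalues_on_four:
  fixes V :: "'a::euclidean_space set"
  assumes V: "subspace V" and B: "bilinear B" and sym: "\<And>X Y. X \<in> V \<Longrightarrow> Y \<in> V \<Longrightarrow> B X Y = B Y X"
    and M: "eigenvalues_on V B {#\<kappa>1, \<kappa>2, \<kappa>3, \<kappa>4#}" and "dim V \<le> 4"
  obtains e1 e2 e3 e4 where "{e1, e2, e3, e4} \<subseteq> V"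
    "norm e1 = 1" "norm e2 = 1" "norm e3 = 1" "norm e4 = 1"
    "e1 \<bullet> e2 = 0" "e1 \<bullet> e3 = 0" "e1 \<bullet> e4 = 0" "e2 \<bullet> e3 = 0" "e2 \<bullet> e4 = 0" "e3 \<bullet> e4 = 0"
    "\<And>X. X \<in> V \<Longrightarrow> X = (X \<bullet> e1) *\<^sub>R e1 + (X \<bullet> e2) *\<^sub>R e2 + (X \<bullet> e3) *\<^sub>R e3 + (X \<bullet> e4) *\<^sub>R e4"
    "\<And>Y. Y \<in> V \<Longrightarrow> B e1 Y = \<kappa>1 * (e1 \<bullet> Y)" "\<And>Y. Y \<in> V \<Longrightarrow> B e2 Y = \<kappa>2 * (e2 \<bullet> Y)"
    "\<And>Y. Y \<in> V \<Longrightarrow> B e3 Y = \<kappa>3 * (e3 \<bullet> Y)" "\<And>Y. Y \<in> V \<Longrightarrow> B e4 Y = \<kappa>4 * (e4 \<bullet> Y)"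
proof -
  obtain E where E: "finite E" "E \<subseteq> V" "pairwise orthogonal E" "\<And>x. x \<in> E \<Longrightarrow> norm x = 1"
    "image_mset (\<lambda>x. B x x) (mset_set E) = {#\<kappa>1, \<kappa>2, \<kappa>3, \<kappa>4#}"
    "\<And>x Y. x \<in> E \<Longrightarrow> Y \<in> V \<Longrightarrow> B x Y = B x x * (x \<bullet> Y)"
    using eigenvalues_on_orthonormal[OF V B M sym] by blast
  obtain e1 M1 where 1: "mset_set E = add_mset e1 M1" "B e1 e1 = \<kappa>1"
    "image_mset (\<lambda>x. B x x) M1 = {#\<kappa>2, \<kappa>3, \<kappa>4#}"
    using msed_map_invR[OF E(5)] by auto
  obtain e2 M2 where 2: "M1 = add_mset e2 M2" "B e2 e2 = \<kappa>2"
    "image_mset (\<lambda>x. B x x) M2 = {#\<kappa>3, \<kappa>4#}"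
    using msed_map_invR[OF 1(3)] by auto
  obtain e3 M3 where 3: "M2 = add_mset e3 M3" "B e3 e3 = \<kappa>3"
    "image_mset (\<lambda>x. B x x) M3 = {#\<kappa>4#}"
    using msed_map_invR[OF 2(3)] by auto
  obtain e4 where 4: "M3 = {#e4#}" "B e4 e4 = \<kappa>4"
    using msed_map_invR[OF 3(3)] by auto
  have ms: "mset_set E = {#e1, e2, e3, e4#}" using 1 2 3 4 by simp
  then have set: "E = {e1, e2, e3, e4}"
    using E(1) by (metis finite_set_mset_mset_set set_mset_add_mset_insert set_mset_empty)
  then have mem: "e1 \<in> E" "e2 \<in> E" "e3 \<in> E" "e4 \<in> E" by simp_all
  have "card E = 4" using arg_cong[OF ms, of size] E(1) by simp
  then have dist: "distinct [e1, e2, e3, e4]"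
    using set by (intro card_distinct) simp
  have orth: "x \<bullet> y = 0" if "x \<in> E" "y \<in> E" "x \<noteq> y" for x y
    using E(3) that by (auto simp: pairwise_def orthogonal_def)
  have ind: "independent E"
    using E(3) E(4)[of 0] by (intro pairwise_orthogonal_independent) auto
  have "V \<subseteq> span E"
    using card_ge_dim_independent[OF E(2) ind] \<open>card E = 4\<close> assms(5) by simp
  then have exp: "X = (\<Sum>b\<in>E. (X \<bullet> b) *\<^sub>R b)" if "X \<in> V" for X
    using orthonormal_basis_expand[OF E(3,4) _ E(1)] that by (metis subsetD inner_commute)
  show ?thesis
  proof (rule that[of e1 e2 e3 e4])
    show "X = (X \<bullet> e1) *\<^sub>R e1 + (X \<bullet> e2) *\<^sub>R e2 + (X \<bullet> e3) *\<^sub>R e3 + (X \<bullet> e4) *\<^sub>R e4" if "X \<in> V" for X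
      using dist by (subst exp[OF that]) (simp add: set add.assoc)
    show "{e1, e2, e3, e4} \<subseteq> V" using E(2) unfolding set .
    show "e1 \<bullet> e2 = 0" "e1 \<bullet> e3 = 0" "e1 \<bullet> e4 = 0" "e2 \<bullet> e3 = 0" "e2 \<bullet> e4 = 0" "e3 \<bullet> e4 = 0"
      using dist mem by (simp_all add: orth)
  qed (simp_all add: mem E(4) E(6) 1(2) 2(2) 3(2) 4(2))
qed

lemma inner_i_smult: "(\<i> *s a) \<bullet> b = - (a \<bullet> (\<i> *s b))" for a b :: "complex^'n"
  by (simp add: inner_vec_def inner_complex_def sum_negf[symmetric])

lemma inner_i_smult_self [simp]: "(\<i> *s a) \<bullet> a = 0" for a :: "complex^'n"
  by (simp add: inner_vec_def inner_complex_def algebra_simps)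

lemma complex_smult_eq: "c *s X = Re c *\<^sub>R X + Im c *\<^sub>R (\<i> *s X)" for X :: "complex^'n"
  by (simp add: vec_eq_iff complex_eq_iff)

text \<open>A first candidate \<open>X0\<close> in the span of \<open>e1\<close> and
  \<open>e2\<close> has its complex line orthogonal to \<open>e4\<close>, where \<open>B\<close> is
  non-positive. If this line is not negative definite, it contains a null vector, which must be a
  multiple of \<open>e3\<close> with \<open>\<kappa>3 = 0\<close>, and a small tilt of
  \<open>e3\<close> towards the span of \<open>e1\<close> and \<open>e2\<close> repairs the
  defect.\<close>

lemma neg_definite_complex_line:
  fixes V :: "(complex^'n) set"
  assumes V: "vec.subspace V" and B: "bilinear B"
    and sym: "\<And>X Y. X \<in> V \<Longrightarrow> Y \<in> V \<Longrightarrow> B X Y = B Y X"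
    and M: "eigenvalues_on V B {#\<kappa>1, \<kappa>2, \<kappa>3, \<kappa>4#}" and dim: "dim V \<le> 4"
    and \<kappa>: "\<kappa>1 < 0" "\<kappa>2 < 0" "\<kappa>3 \<le> 0"
  obtains v where "v \<in> V" "\<And>c. c \<noteq> 0 \<Longrightarrow> B (c *s v) (c *s v) < 0"
proof -
  have smult: "c *s X \<in> V" if "X \<in> V" for c X using V that by (rule vec.subspace_scale)
  have sR: "c *\<^sub>R X = of_real c *s X" for c and X :: "complex^'n" by (simp add: vec_eq_iff complex_eq_iff)
  have Vr: "subspace V"
    using V by (auto simp: subspace_def vec.subspace_def sR)
  obtain e1 e2 e3 e4 where e: "{e1, e2, e3, e4} \<subseteq> V"
    and n: "norm e1 = 1" "norm e2 = 1" "norm e3 = 1" "norm e4 = 1"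
    and o: "e1 \<bullet> e2 = 0" "e1 \<bullet> e3 = 0" "e1 \<bullet> e4 = 0" "e2 \<bullet> e3 = 0" "e2 \<bullet> e4 = 0" "e3 \<bullet> e4 = 0"
    and ex: "\<And>X. X \<in> V \<Longrightarrow> X = (X \<bullet> e1) *\<^sub>R e1 + (X \<bullet> e2) *\<^sub>R e2 + (X \<bullet> e3) *\<^sub>R e3 + (X \<bullet> e4) *\<^sub>R e4"
    and eig: "\<And>Y. Y \<in> V \<Longrightarrow> B e1 Y = \<kappa>1 * (e1 \<bullet> Y)" "\<And>Y. Y \<in> V \<Longrightarrow> B e2 Y = \<kappa>2 * (e2 \<bullet> Y)"
      "\<And>Y. Y \<in> V \<Longrightarrow> B e3 Y = \<kappa>3 * (e3 \<bullet> Y)" "\<And>Y. Y \<in> V \<Longrightarrow> B e4 Y = \<kappa>4 * (e4 \<bullet> Y)"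
    using eigenvalues_on_four[OF Vr B sym M dim] by metis
  note Bs = bilinear_ladd[OF B] bilinear_radd[OF B] bilinear_lmul[OF B] bilinear_rmul[OF B]
  have n': "e1 \<bullet> e1 = 1" "e2 \<bullet> e2 = 1" "e3 \<bullet> e3 = 1" "e4 \<bullet> e4 = 1"
    using n by (simp_all add: norm_eq_1)
  have o': "e2 \<bullet> e1 = 0" "e3 \<bullet> e1 = 0" "e4 \<bullet> e1 = 0" "e3 \<bullet> e2 = 0" "e4 \<bullet> e2 = 0" "e4 \<bullet> e3 = 0"
    using o by (simp_all add: inner_commute)
  have BXY: "B X Y = \<kappa>1 * (X \<bullet> e1) * (Y \<bullet> e1) + \<kappa>2 * (X \<bullet> e2) * (Y \<bullet> e2)
      + \<kappa>3 * (X \<bullet> e3) * (Y \<bullet> e3) + \<kappa>4 * (X \<bullet> e4) * (Y \<bullet> e4)" if "X \<in> V" "Y \<in> V" for X Y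
  proof -
    have "B X Y = B ((X \<bullet> e1) *\<^sub>R e1 + (X \<bullet> e2) *\<^sub>R e2 + (X \<bullet> e3) *\<^sub>R e3 + (X \<bullet> e4) *\<^sub>R e4) Y"
      using ex[OF that(1)] by simp
    then show ?thesis using that eig by (simp add: Bs inner_commute algebra_simps)
  qed
  \<comment> \<open>\<open>X0\<close> is chosen such that \<open>\<complex>X0\<close> lies in the non-positive space spanned by \<open>e1, e2, e3\<close>\<close>
  define y where "y = \<i> *s e4"
  define X0 where "X0 = (if y \<bullet> e1 = 0 then e1 else (y \<bullet> e2) *\<^sub>R e1 - (y \<bullet> e1) *\<^sub>R e2)"
  have X0: "X0 \<in> V" using e Vr by (auto simp: X0_def intro!: subspace_diff subspace_scale)
  have X0i: "X0 \<bullet> y = 0" "X0 \<bullet> e4 = 0"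
    by (auto simp: X0_def inner_diff_left o inner_commute[of y])
  have X0n: "X0 \<noteq> 0"
  proof
    assume z: "X0 = 0"
    then have "X0 \<bullet> e1 = 0" "X0 \<bullet> e2 = 0" by auto
    then show False by (auto simp: X0_def inner_diff_left o o' n' split: if_splits)
  qed
  have c4: "(c *s X0) \<bullet> e4 = 0" for c
    using X0i by (simp add: complex_smult_eq[of c] inner_add_left inner_i_smult y_def)
  have Bc: "B (c *s X0) (c *s X0) = \<kappa>1 * ((c *s X0) \<bullet> e1)\<^sup>2 + \<kappa>2 * ((c *s X0) \<bullet> e2)\<^sup>2
      + \<kappa>3 * ((c *s X0) \<bullet> e3)\<^sup>2" for c
    using BXY[OF smult smult, OF X0 X0, of c c] c4 by (simp add: power2_eq_square)
  show ?thesis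
  proof (cases "\<forall>c. c \<noteq> 0 \<longrightarrow> B (c *s X0) (c *s X0) < 0")
    case True
    then show ?thesis using that X0 by blast
  next
    case False
    then obtain c where c: "c \<noteq> 0" "B (c *s X0) (c *s X0) \<ge> 0" by (meson not_le)
    define Z where "Z = c *s X0"
    have ZV: "Z \<in> V" and Z0: "Z \<noteq> 0" using smult X0 X0n c by (auto simp: Z_def)
    have le: "\<kappa>1 * (Z \<bullet> e1)\<^sup>2 \<le> 0" "\<kappa>2 * (Z \<bullet> e2)\<^sup>2 \<le> 0" "\<kappa>3 * (Z \<bullet> e3)\<^sup>2 \<le> 0"
      using \<kappa> by (auto intro!: mult_nonpos_nonneg)
    have "\<kappa>1 * (Z \<bullet> e1)\<^sup>2 = 0" "\<kappa>2 * (Z \<bullet> e2)\<^sup>2 = 0" "\<kappa>3 * (Z \<bullet> e3)\<^sup>2 = 0"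
      using le c(2) Bc[of c] unfolding Z_def by linarith+
    then have z: "Z \<bullet> e1 = 0" "Z \<bullet> e2 = 0" "\<kappa>3 = 0 \<or> Z \<bullet> e3 = 0" using \<kappa> by auto
    have "Z = (Z \<bullet> e3) *\<^sub>R e3" using ex[OF ZV] z c4[of c] by (simp add: Z_def)
    then have z3: "Z \<bullet> e3 \<noteq> 0" using Z0 by auto
    then have k3: "\<kappa>3 = 0" using z by simp
    define d where "d = c / (Z \<bullet> e3)"
    have "e3 = (1 / (Z \<bullet> e3)) *\<^sub>R Z" using \<open>Z = (Z \<bullet> e3) *\<^sub>R e3\<close> z3
      by (metis divideR_right scaleR_one scaleR_scaleR inverse_eq_divide)
    then have e3: "e3 = d *s X0" by (simp add: d_def sR Z_def)
    \<comment> \<open>\<open>w\<close> is orthogonal to \<open>e3\<close>, and to \<open>e4\<close>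
      because it lies on the line of \<open>X0\<close>. So it is in the span of \<open>e1\<close>
      and \<open>e2\<close>, where \<open>B\<close> is negative definite.\<close>
    define w where "w = \<i> *s e3"
    have wV: "w \<in> V" using e smult by (simp add: w_def)
    have "w \<bullet> e4 = 0" using c4[of "\<i> * d"] by (simp add: w_def e3)
    moreover have w3: "w \<bullet> e3 = 0" by (simp add: w_def)
    ultimately have w: "w = (w \<bullet> e1) *\<^sub>R e1 + (w \<bullet> e2) *\<^sub>R e2" using ex[OF wV] by simp
    define \<alpha> \<beta> where "\<alpha> = w \<bullet> e1" and "\<beta> = w \<bullet> e2"
    have "e3 = - (\<i> *s w)" by (simp add: w_def vec_eq_iff)
    then have "w \<noteq> 0" using n(3) by auto
    then have ab: "\<alpha> \<noteq> 0 \<or> \<beta> \<noteq> 0" using w by (auto simp: \<alpha>_def \<beta>_def)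
    \<comment> \<open>now \<open>e3\<close> is a null vector in \<open>\<complex>X0\<close>; it is perturbed by an \<open>x\<close> that is \<open>B\<close>-orthogonal to \<open>w\<close>\<close>
    define x where "x = (\<kappa>1 * \<alpha>) *\<^sub>R e2 - (\<kappa>2 * \<beta>) *\<^sub>R e1"
    have xV: "x \<in> V" using e Vr by (auto simp: x_def intro!: subspace_diff subspace_scale)
    have x: "x \<bullet> e1 = - \<kappa>2 * \<beta>" "x \<bullet> e2 = \<kappa>1 * \<alpha>" "x \<bullet> e3 = 0" "x \<bullet> e4 = 0"
      by (auto simp: x_def inner_diff_left o o' n')
    have Bxx: "B x x < 0"
    proof -
      have "B x x = \<kappa>1 * (\<kappa>2 * \<beta>)\<^sup>2 + \<kappa>2 * (\<kappa>1 * \<alpha>)\<^sup>2"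
        using BXY[OF xV xV] by (simp add: x power2_eq_square algebra_simps)
      moreover have "\<kappa>1 * (\<kappa>2 * \<beta>)\<^sup>2 \<le> 0" "\<kappa>2 * (\<kappa>1 * \<alpha>)\<^sup>2 \<le> 0"
        using \<kappa> by (auto intro!: mult_nonpos_nonneg)
      moreover have "\<kappa>1 * (\<kappa>2 * \<beta>)\<^sup>2 < 0 \<or> \<kappa>2 * (\<kappa>1 * \<alpha>)\<^sup>2 < 0"
        using \<kappa> ab by (auto simp: mult_less_0_iff)
      ultimately show ?thesis by linarith
    qed
    have Bww: "B w w < 0"
    proof -
      have "B w w = \<kappa>1 * \<alpha>\<^sup>2 + \<kappa>2 * \<beta>\<^sup>2"
        using BXY[OF wV wV] w3 \<open>w \<bullet> e4 = 0\<close> by (simp add: \<alpha>_def \<beta>_def power2_eq_square algebra_simps)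
      moreover have "\<kappa>1 * \<alpha>\<^sup>2 \<le> 0" "\<kappa>2 * \<beta>\<^sup>2 \<le> 0"
        using \<kappa> by (auto intro!: mult_nonpos_nonneg)
      moreover have "\<kappa>1 * \<alpha>\<^sup>2 < 0 \<or> \<kappa>2 * \<beta>\<^sup>2 < 0"
        using \<kappa> ab by (auto simp: mult_less_0_iff)
      ultimately show ?thesis by linarith
    qed
    have Bwx: "B w x = 0"
      using BXY[OF wV xV] by (simp add: x w3 \<alpha>_def \<beta>_def)
    have e3V: "e3 \<in> V" using e by simp
    have B3: "B e3 Y = 0" "B Y e3 = 0" if "Y \<in> V" for Y
      using eig(3)[OF that] k3 sym[OF that e3V] by auto
    define ix where "ix = \<i> *s x"
    have ixV: "ix \<in> V" using smult xV by (simp add: ix_def)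
    \<comment> \<open>These are the coefficients of the form on the complex line of the tilted
      vector. The second summand of \<open>l\<close> is the price of absorbing the mixed term with
      \<open>m\<close> into half of the \<open>Q\<close> term.\<close>
    define P Q m k l where "P = - B w w" and "Q = - B x x" and "m = B x ix" and "k = B w ix"
      and "l = B ix ix + 2 * m\<^sup>2 / Q"
    have PQ: "P > 0" "Q > 0" using Bww Bxx by (auto simp: P_def Q_def)
    \<comment> \<open>So small that the terms in \<open>k\<close> and \<open>l\<close> stay below
      \<open>P\<close>, the gain from \<open>w\<close>.\<close>
    define s where "s = min 1 (P / (2 * (2 * \<bar>k\<bar> + \<bar>l\<bar> + 1)))"
    have s: "0 < s" "s \<le> 1" using PQ by (auto simp: s_def)
    have "s * (2 * \<bar>k\<bar> + \<bar>l\<bar> + 1) \<le> P / (2 * (2 * \<bar>k\<bar> + \<bar>l\<bar> + 1)) * (2 * \<bar>k\<bar> + \<bar>l\<bar> + 1)"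
      by (intro mult_right_mono) (auto simp: s_def)
    also have "\<dots> = P / 2"
    proof -
      have "2 * \<bar>k\<bar> + \<bar>l\<bar> + 1 \<noteq> 0" by linarith
      then show ?thesis by (simp add: field_simps)
    qed
    finally have sP: "s * (2 * \<bar>k\<bar> + \<bar>l\<bar> + 1) \<le> P / 2" .
    have sk: "2 * s * k + s\<^sup>2 * l < P"
    proof -
      have "2 * s * k \<le> s * (2 * \<bar>k\<bar>)" using s by simp
      moreover have "s\<^sup>2 * l \<le> s\<^sup>2 * \<bar>l\<bar>" by (intro mult_left_mono) auto
      moreover have "s\<^sup>2 * \<bar>l\<bar> \<le> s * \<bar>l\<bar>"
        using s by (intro mult_right_mono) (auto simp: power2_eq_square mult_left_le)
      ultimately have "2 * s * k + s\<^sup>2 * l \<le> s * (2 * \<bar>k\<bar> + \<bar>l\<bar> + 1) - s" by (simp add: algebra_simps)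
      then show ?thesis using sP PQ s by linarith
    qed
    show ?thesis
    proof (rule that[of "e3 + s *\<^sub>R x"])
      show "e3 + s *\<^sub>R x \<in> V" using e3V xV Vr by (intro subspace_add subspace_scale) auto
      fix c :: complex assume "c \<noteq> 0"
      define a b where "a = Re c" and "b = Im c"
      have ab: "a \<noteq> 0 \<or> b \<noteq> 0" using \<open>c \<noteq> 0\<close> by (auto simp: a_def b_def complex_eq_iff)
      have "\<i> *s (s *\<^sub>R x) = s *\<^sub>R ix" by (simp add: vec_eq_iff ix_def complex_eq_iff)
      then have "c *s (e3 + s *\<^sub>R x) = a *\<^sub>R (e3 + s *\<^sub>R x) + b *\<^sub>R (w + s *\<^sub>R ix)"
        unfolding complex_smult_eq[of c] a_def b_def w_def by (simp add: linear_add[OF i_smult_linear])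
      then have "B (c *s (e3 + s *\<^sub>R x)) (c *s (e3 + s *\<^sub>R x))
          = - (a\<^sup>2 * s\<^sup>2 * Q) + 2 * a * b * s\<^sup>2 * m + b\<^sup>2 * (- P + 2 * s * k + s\<^sup>2 * B ix ix)"
        using B3[OF xV] B3[OF wV] B3[OF ixV] B3[OF e3V] Bwx sym[OF wV xV] sym[OF wV ixV] sym[OF xV ixV]
        by (simp add: Bs P_def Q_def m_def k_def power2_eq_square algebra_simps)
      moreover have "2 * a * b * s\<^sup>2 * m \<le> a\<^sup>2 * s\<^sup>2 * Q / 2 + b\<^sup>2 * s\<^sup>2 * (2 * m\<^sup>2 / Q)"
      proof -
        have "0 \<le> (a * Q - 2 * b * m)\<^sup>2 * s\<^sup>2 / (2 * Q)" using PQ by simp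
        also have "\<dots> = a\<^sup>2 * s\<^sup>2 * Q / 2 + b\<^sup>2 * s\<^sup>2 * (2 * m\<^sup>2 / Q) - 2 * a * b * s\<^sup>2 * m"
          using PQ by (simp add: field_simps power2_eq_square)
        finally show ?thesis by simp
      qed
      ultimately have "B (c *s (e3 + s *\<^sub>R x)) (c *s (e3 + s *\<^sub>R x))
          \<le> - (a\<^sup>2 * s\<^sup>2 * Q / 2) + b\<^sup>2 * (2 * s * k + s\<^sup>2 * l - P)"
        by (simp add: l_def algebra_simps)
      moreover have "- (a\<^sup>2 * s\<^sup>2 * Q / 2) \<le> 0" "b\<^sup>2 * (2 * s * k + s\<^sup>2 * l - P) \<le> 0"
        using PQ sk by (auto intro: mult_nonneg_nonpos)
      moreover have "- (a\<^sup>2 * s\<^sup>2 * Q / 2) < 0 \<or> b\<^sup>2 * (2 * s * k + s\<^sup>2 * l - P) < 0"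
        using ab PQ sk s by (auto simp: mult_less_0_iff)
      ultimately show "B (c *s (e3 + s *\<^sub>R x)) (c *s (e3 + s *\<^sub>R x)) < 0" by linarith
    qed
  qed
qed


section \<open>Sections through a boundary point\<close>

lemma norm_complex_smult: "norm (c *s X) = cmod c * norm X" for X :: "complex^'n"
  by (simp add: norm_vec_def norm_mult L2_set_right_distrib)

lemma scaleR_complex_smult: "c *\<^sub>R X = of_real c *s X" for X :: "complex^'n"
  by (simp add: vec_eq_iff complex_eq_iff)

locale boundary_point =
  fixes D U :: "(complex^'n) set" and p :: "complex^'n" and r :: "complex^'n \<Rightarrow> real"
  assumes p_frontier: "p \<in> frontier D"
    and defining: "defining_function D p U r" and C1: "C1_on U r"
    and grad: "\<exists>X. frechet_derivative r (at p) X \<noteq> 0"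
    and twice: "twice_differentiable_at r p"
begin

abbreviation "dr \<equiv> frechet_derivative r (at p)"
abbreviation "H \<equiv> hessian r p"
abbreviation "T \<equiv> tangent_directions r p"

text \<open>Negativity on the whole complex line ensures that a small disc
  \<open>p + \<zeta> *s V\<close> lies in \<open>D\<close> except for its centre.\<close>

definition neg_line :: "complex^'n \<Rightarrow> bool" where
  "neg_line V \<longleftrightarrow> V \<in> T \<and> (\<forall>c. c \<noteq> 0 \<longrightarrow> H (c *s V) (c *s V) < 0)"

lemma U: "open U" "p \<in> U"
  using defining by (auto simp: defining_function_def)

lemma mem_D_iff: "z \<in> U \<Longrightarrow> z \<in> D \<longleftrightarrow> r z < 0"
  using defining by (auto simp: defining_function_def)

lemma mem_frontier_iff: "z \<in> U \<Longrightarrow> z \<in> frontier D \<longleftrightarrow> r z = 0"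
  using defining by (auto simp: defining_function_def)

lemma r_p: "r p = 0" and p_notin_D: "p \<notin> D"
  using mem_frontier_iff mem_D_iff p_frontier U(2) by auto

lemma differentiable: "z \<in> U \<Longrightarrow> r differentiable (at z)"
  using C1 by (simp add: C1_on_def)

lemma dr_linear: "linear dr"
  using linear_frechet_derivative_real differentiable U(2) by blast

lemma T_iff: "X \<in> T \<longleftrightarrow> dr X = 0 \<and> dr (\<i> *s X) = 0"
  using tangent_directions_iff differentiable U(2) by blast

lemma T_subspace: "vec.subspace T"
  by (rule subspace_tangent_directions)

lemma dr_smult: "dr (c *s X) = Re c * dr X + Im c * dr (\<i> *s X)"
  by (simp add: complex_smult_eq[of c] linear_add[OF dr_linear] linear_cmul[OF dr_linear])

lemma dr_smult_T: "X \<in> T \<Longrightarrow> dr (c *s X) = 0"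
  by (simp add: dr_smult[of c X] T_iff)

lemma H_bilinear: "bilinear H"
  by (rule bilinear_hessian[OF twice])

lemma normal_vector:
  obtains N where "dr N = 1" "dr (\<i> *s N) = 0" "N \<notin> T" "\<And>c. dr (c *s N) = Re c"
proof -
  obtain X where X: "dr X \<noteq> 0" using grad by blast
  define \<alpha> \<beta> where "\<alpha> = dr X" and "\<beta> = dr (\<i> *s X)"
  \<comment> \<open>\<open>c\<close> is the inverse of \<open>\<alpha> - \<i> * \<beta>\<close>, the
    value at \<open>X\<close> of the complex linear form
    \<open>Y \<mapsto> dr Y - \<i> * dr (\<i> *s Y)\<close>; thus this form is 1 at
    \<open>c *s X\<close>.\<close>
  define c where "c = Complex (\<alpha> / (\<alpha>\<^sup>2 + \<beta>\<^sup>2)) (\<beta> / (\<alpha>\<^sup>2 + \<beta>\<^sup>2))"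
  have ne: "\<alpha>\<^sup>2 + \<beta>\<^sup>2 \<noteq> 0" using X by (simp add: \<alpha>_def sum_power2_eq_zero_iff)
  have "dr (c *s X) = Re c * \<alpha> + Im c * \<beta>" by (simp only: dr_smult[of c] \<alpha>_def \<beta>_def)
  also have "\<dots> = 1" using ne by (simp add: c_def power2_eq_square add_divide_distrib[symmetric])
  finally have 1: "dr (c *s X) = 1" .
  have "dr ((\<i> * c) *s X) = Re (\<i> * c) * \<alpha> + Im (\<i> * c) * \<beta>"
    by (simp only: dr_smult[of "\<i> * c"] \<alpha>_def \<beta>_def)
  also have "\<dots> = 0" by (simp add: c_def)
  finally have 2: "dr (\<i> *s (c *s X)) = 0" by simp
  show ?thesis
    using that[of "c *s X"] 1 2 dr_smult[of _ "c *s X"] by (auto simp: T_iff)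
qed

text \<open>This is the second-order expansion at \<open>\<zeta> *s V + Z\<close>. The linear term
  in \<open>V\<close> vanishes by tangency, and compactness of the unit circle turns negativity
  along \<open>V\<close> into a uniform bound.\<close>

lemma local_estimate:
  assumes V: "neg_line V"
  obtains m C \<rho> where "m > 0" "C > 0" "\<rho> > 0"
    "\<And>\<zeta> Z. cmod \<zeta> \<le> \<rho> \<Longrightarrow> norm Z \<le> \<rho> \<Longrightarrow>
      p + \<zeta> *s V + Z \<in> U \<and> r (p + \<zeta> *s V + Z) \<le> dr Z - m * (cmod \<zeta>)\<^sup>2 + C * (norm Z)\<^sup>2"
proof -
  note Bs = bilinear_ladd[OF H_bilinear] bilinear_radd[OF H_bilinear]
    bilinear_lmul[OF H_bilinear] bilinear_rmul[OF H_bilinear]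
  have Hz: "H (\<zeta> *s V) (\<zeta> *s V) = Re \<zeta> * (Re \<zeta> * H V V + Im \<zeta> * H V (\<i> *s V))
      + Im \<zeta> * (Re \<zeta> * H (\<i> *s V) V + Im \<zeta> * H (\<i> *s V) (\<i> *s V))" for \<zeta>
    unfolding complex_smult_eq[of \<zeta>] by (simp add: Bs distrib_left)
  have "continuous_on (sphere 0 1) (\<lambda>\<zeta>. H (\<zeta> *s V) (\<zeta> *s V))"
    by (rule continuous_on_eq[OF _ Hz[symmetric]]) (intro continuous_intros)
  moreover have "sphere (0::complex) 1 \<noteq> {}" by simp
  ultimately obtain \<zeta>1 where "\<zeta>1 \<in> sphere 0 1"
    "\<forall>\<zeta>\<in>sphere 0 1. H (\<zeta> *s V) (\<zeta> *s V) \<le> H (\<zeta>1 *s V) (\<zeta>1 *s V)"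
    using continuous_attains_sup[OF compact_sphere] by blast
  then have z1: "cmod \<zeta>1 = 1"
    "cmod \<zeta> = 1 \<Longrightarrow> H (\<zeta> *s V) (\<zeta> *s V) \<le> H (\<zeta>1 *s V) (\<zeta>1 *s V)" for \<zeta>
    by auto
  define M where "M = - H (\<zeta>1 *s V) (\<zeta>1 *s V)"
  have M: "M > 0" using V z1(1) unfolding neg_line_def M_def by (metis neg_0_less_iff_less norm_zero zero_neq_one)
  have HV: "H (\<zeta> *s V) (\<zeta> *s V) \<le> - M * (cmod \<zeta>)\<^sup>2" for \<zeta>
  proof (cases "\<zeta> = 0")
    case True
    then show ?thesis using bilinear_lzero[OF H_bilinear] by simp
  next
    case False
    define \<eta> where "\<eta> = \<zeta> / cmod \<zeta>"
    have "\<zeta> *s V = cmod \<zeta> *\<^sub>R (\<eta> *s V)" using False by (simp add: \<eta>_def scaleR_complex_smult)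
    then have "H (\<zeta> *s V) (\<zeta> *s V) = (cmod \<zeta>)\<^sup>2 * H (\<eta> *s V) (\<eta> *s V)"
      by (simp add: Bs power2_eq_square)
    also have "\<dots> \<le> (cmod \<zeta>)\<^sup>2 * (- M)"
      using z1(2)[of \<eta>] False by (intro mult_left_mono) (auto simp: M_def \<eta>_def norm_divide)
    finally show ?thesis by (simp add: mult.commute)
  qed
  obtain K where K: "K > 0" "\<And>X Y. \<bar>H X Y\<bar> \<le> K * norm X * norm Y"
    using bilinear_bounded_pos[OF H_bilinear] by auto
  define v where "v = norm V"
  define q where "q = v\<^sup>2 + 1"
  define e where "e = M / 16 / q"
  have q: "q > 0" by (simp add: q_def add_nonneg_pos)
  then have e: "e > 0" using M by (simp add: e_def)
  have ev: "2 * e * v\<^sup>2 \<le> M / 8"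
  proof -
    have "e * q = M / 16" using q by (simp add: e_def)
    then have "e * v\<^sup>2 + e = M / 16" by (simp add: q_def distrib_left)
    then show ?thesis using e by linarith
  qed
  obtain d where d: "d > 0" "\<And>h. norm h < d \<Longrightarrow> \<bar>r (p + h) - r p - dr h - H h h / 2\<bar> \<le> e * (norm h)\<^sup>2"
    by (rule taylor_hessian[OF twice e]) (rule that)
  obtain R where R: "R > 0" "ball p R \<subseteq> U" using U open_contains_ball by blast
  define \<rho> where "\<rho> = min d R / 2 / (v + 1)"
  have vn: "v + 1 > 0" by (simp add: v_def add_nonneg_pos)
  have \<rho>: "\<rho> > 0" using d(1) R(1) vn by (simp add: \<rho>_def)
  define C where "C = 2 * K\<^sup>2 * v\<^sup>2 / M + K / 2 + 2 * e"
  have C: "C > 0" using M K e by (simp add: C_def add_nonneg_pos)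
  \<comment> \<open>Half of the Hessian along \<open>V\<close> contributes \<open>- M / 2\<close>
    times the square of \<open>cmod \<zeta>\<close>. The Taylor remainder and the mixed terms cost
    \<open>M / 8\<close> each, which leaves \<open>M / 4\<close>.\<close>
  show ?thesis
  proof (rule that[of "M / 4" C \<rho>])
    fix \<zeta> and Z :: "complex^'n" assume le: "cmod \<zeta> \<le> \<rho>" "norm Z \<le> \<rho>"
    define h where "h = \<zeta> *s V + Z"
    define x z where "x = cmod \<zeta>" and "z = norm Z"
    have xz: "x \<ge> 0" "z \<ge> 0" by (auto simp: x_def z_def)
    have nh: "norm h \<le> x * v + z"
      unfolding h_def x_def z_def v_def using norm_triangle_ineq[of "\<zeta> *s V" Z]
      by (simp add: norm_complex_smult)
    also have "\<dots> \<le> \<rho> * v + \<rho>" using le by (intro add_mono mult_right_mono) (auto simp: x_def z_def v_def)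
    also have "\<dots> = \<rho> * (v + 1)" by (simp add: distrib_left)
    also have "\<dots> = min d R / 2"
      using nonzero_eq_divide_eq[of "v + 1" \<rho> "min d R / 2"] vn \<rho>_def by simp
    also have "\<dots> < min d R" using d(1) R(1) by (simp add: min_def)
    finally have small: "norm h < d" "norm h < R" by simp_all
    then have "p + h \<in> ball p R" by (simp add: dist_norm)
    then have "p + h \<in> U" using R by blast
    have "(norm h)\<^sup>2 \<le> (x * v + z)\<^sup>2" using nh by (intro power_mono) auto
    also have "\<dots> \<le> 2 * (x * v)\<^sup>2 + 2 * z\<^sup>2" using sum_squares_bound[of "x * v" z] by (simp add: power2_sum)
    finally have "e * (norm h)\<^sup>2 \<le> 2 * e * v\<^sup>2 * x\<^sup>2 + 2 * e * z\<^sup>2"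
      using mult_left_mono[of "(norm h)\<^sup>2" "2 * (x * v)\<^sup>2 + 2 * z\<^sup>2" e] e
      by (simp add: algebra_simps power_mult_distrib)
    also have "\<dots> \<le> M / 8 * x\<^sup>2 + 2 * e * z\<^sup>2"
      using mult_right_mono[OF ev, of "x\<^sup>2"] by simp
    finally have 1: "e * (norm h)\<^sup>2 \<le> M / 8 * x\<^sup>2 + 2 * e * z\<^sup>2" .
    have 2: "H h h \<le> - M * x\<^sup>2 + 2 * (K * (x * v) * z) + K * z\<^sup>2"
    proof -
      have "H h h = H (\<zeta> *s V) (\<zeta> *s V) + H (\<zeta> *s V) Z + H Z (\<zeta> *s V) + H Z Z"
        by (simp add: h_def Bs)
      moreover have "H (\<zeta> *s V) (\<zeta> *s V) \<le> - M * x\<^sup>2" using HV[of \<zeta>] by (simp only: x_def)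
      moreover have "H (\<zeta> *s V) Z \<le> K * (x * v) * z" "H Z (\<zeta> *s V) \<le> K * z * (x * v)" "H Z Z \<le> K * z * z"
        using K(2)[of "\<zeta> *s V" Z] K(2)[of Z "\<zeta> *s V"] K(2)[of Z Z]
        by (auto simp: norm_complex_smult x_def z_def v_def)
      moreover have "K * z * (x * v) = K * (x * v) * z" "K * z * z = K * z\<^sup>2"
        by (simp_all add: power2_eq_square)
      ultimately show ?thesis by linarith
    qed
    have 3: "K * (x * v) * z \<le> M / 8 * x\<^sup>2 + 2 * K\<^sup>2 * v\<^sup>2 / M * z\<^sup>2"
    proof -
      have "0 \<le> (M * x - 4 * K * v * z)\<^sup>2 / (8 * M)" using M by simp
      also have "\<dots> = M / 8 * x\<^sup>2 + 2 * K\<^sup>2 * v\<^sup>2 / M * z\<^sup>2 - K * (x * v) * z"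
        using M by (simp add: field_simps power2_eq_square)
      finally show ?thesis by linarith
    qed
    have "dr h = dr Z"
      using dr_smult_T V by (simp add: h_def neg_line_def linear_add[OF dr_linear])
    then have "r (p + h) \<le> dr Z + H h h / 2 + e * (norm h)\<^sup>2"
      using d(2)[OF small(1)] r_p by linarith
    then have "r (p + h) \<le> dr Z - M / 4 * x\<^sup>2 + (2 * K\<^sup>2 * v\<^sup>2 / M * z\<^sup>2 + K / 2 * z\<^sup>2 + 2 * e * z\<^sup>2)"
      using 1 2 3 by linarith
    also have "\<dots> = dr Z - M / 4 * x\<^sup>2 + C * z\<^sup>2" by (simp add: C_def algebra_simps)
    finally show "p + \<zeta> *s V + Z \<in> U \<and> r (p + \<zeta> *s V + Z) \<le> dr Z - M / 4 * (cmod \<zeta>)\<^sup>2 + C * (norm Z)\<^sup>2"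
      using \<open>p + h \<in> U\<close> by (simp add: h_def x_def z_def add.assoc)
  qed (use M C \<rho> in auto)
qed

lemma neg_line_nonzero:
  assumes "neg_line V"
  shows "V \<noteq> 0"
proof
  assume "V = 0"
  then have "H (1 *s 0) (1 *s 0) < 0" using assms unfolding neg_line_def by (metis zero_neq_one)
  then show False using bilinear_lzero[OF H_bilinear] by simp
qed

lemma cindep_transverse:
  assumes "V \<in> T" "V \<noteq> 0" "N \<notin> T"
  shows "cindep N V"
  unfolding cindep_def
proof (intro allI impI)
  fix t \<zeta> assume eq: "t *s N + \<zeta> *s V = 0"
  have "t = 0"
  proof (rule ccontr)
    assume "t \<noteq> 0"
    then have "N = (- \<zeta> / t) *s V" using eq by (auto simp: vec_eq_iff field_simps eq_neg_iff_add_eq_0)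
    then show False using assms(1,3) vec.subspace_scale[OF T_subspace] by metis
  qed
  then show "t = 0 \<and> \<zeta> = 0" using eq assms(2) by simp
qed

text \<open>The disc in direction \<open>V\<close> is pushed from \<open>p\<close> along an inward
  multiple of \<open>N\<close>. The pushed closed discs lie in \<open>D\<close>, and so does the
  boundary circle of the unpushed one; pseudoconvexity would then put its centre \<open>p\<close>
  into \<open>D\<close>.\<close>

lemma transverse_plane_nonpseudoconvex:
  assumes V: "neg_line V" and N: "N \<notin> T"
  shows "\<not> pseudoconvex_in (cplane p N V) (cplane p N V \<inter> D)"
proof
  assume psc: "pseudoconvex_in (cplane p N V) (cplane p N V \<inter> D)"
  obtain m C \<rho> where est: "m > 0" "C > 0" "\<rho> > 0"
    "\<And>\<zeta> Z. cmod \<zeta> \<le> \<rho> \<Longrightarrow> norm Z \<le> \<rho> \<Longrightarrow>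
      p + \<zeta> *s V + Z \<in> U \<and> r (p + \<zeta> *s V + Z) \<le> dr Z - m * (cmod \<zeta>)\<^sup>2 + C * (norm Z)\<^sup>2"
    using local_estimate[OF V] by metis
  have dc: "dr (1 *s N) = dr N" "dr ((-1) *s N) = - dr N" "dr ((- \<i>) *s N) = - dr (\<i> *s N)"
    using dr_smult[of 1 N] dr_smult[of "-1" N] dr_smult[of "- \<i>" N] by simp_all
  \<comment> \<open>As \<open>N \<notin> T\<close>, one of the multiples of \<open>N\<close> by
    \<open>1\<close>, \<open>-1\<close>, \<open>\<i>\<close>, \<open>- \<i>\<close> points into
    \<open>D\<close> to first order.\<close>
  consider "dr N < 0" | "dr N > 0" | "dr (\<i> *s N) < 0" | "dr (\<i> *s N) > 0"
    using N unfolding T_iff by linarith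
  then obtain c where c: "dr (c *s N) < 0"
    using dc by cases (metis neg_less_0_iff_less)+
  define \<kappa> n where "\<kappa> = - dr (c *s N)" and "n = norm (c *s N)"
  have \<kappa>: "\<kappa> > 0" using c by (simp add: \<kappa>_def)
  \<comment> \<open>The first bound keeps the shift in the range of the estimate; the second makes
    its quadratic cost smaller than the linear gain \<open>x * \<kappa>\<close>.\<close>
  define \<tau> where "\<tau> = min (\<rho> / (n + 1)) (\<kappa> / (C * n\<^sup>2 + 1))"
  have n1: "n + 1 > 0" "C * n\<^sup>2 + 1 > 0" using est(2) by (auto simp: n_def add_nonneg_pos)
  have \<tau>: "\<tau> > 0" using est \<kappa> n1 by (simp add: \<tau>_def)
  have inD: "p + (of_real x * c) *s N + \<zeta> *s V \<in> D"
    if x: "0 \<le> x" "x \<le> \<tau>" and \<zeta>: "cmod \<zeta> \<le> \<rho>" and or: "x > 0 \<or> cmod \<zeta> = \<rho>" for x \<zeta>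
  proof -
    let ?Z = "x *\<^sub>R (c *s N)"
    have nZ: "norm ?Z = x * n" using x by (simp add: n_def)
    have "x * n \<le> \<tau> * (n + 1)" using x \<tau> n1 by (intro mult_mono) (auto simp: n_def)
    also have "\<dots> \<le> \<rho> / (n + 1) * (n + 1)" using n1 by (intro mult_right_mono) (auto simp: \<tau>_def)
    finally have le: "norm ?Z \<le> \<rho>" using n1 nZ by simp
    have "x * (C * n\<^sup>2) < \<kappa>"
    proof -
      have "x * (C * n\<^sup>2) \<le> \<tau> * (C * n\<^sup>2)" using x est(2) by (intro mult_right_mono) auto
      also have "\<dots> < \<tau> * (C * n\<^sup>2 + 1)" using \<tau> by (simp add: distrib_left)
      also have "\<dots> \<le> \<kappa> / (C * n\<^sup>2 + 1) * (C * n\<^sup>2 + 1)" using n1 by (intro mult_right_mono) (auto simp: \<tau>_def)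
      finally show ?thesis using n1 by simp
    qed
    then have q: "x * (x * (C * n\<^sup>2)) \<le> x * \<kappa>" "x > 0 \<Longrightarrow> x * (x * (C * n\<^sup>2)) < x * \<kappa>"
      using x by (auto intro: mult_left_mono)
    have sq: "m * (cmod \<zeta>)\<^sup>2 \<ge> 0" "cmod \<zeta> = \<rho> \<Longrightarrow> m * (cmod \<zeta>)\<^sup>2 > 0"
      using est by auto
    have "r (p + \<zeta> *s V + ?Z) \<le> - (x * \<kappa>) - m * (cmod \<zeta>)\<^sup>2 + x * (x * (C * n\<^sup>2))"
    proof -
      have "dr ?Z = - (x * \<kappa>)" by (simp add: linear_cmul[OF dr_linear] \<kappa>_def)
      moreover have "C * (norm ?Z)\<^sup>2 = x * (x * (C * n\<^sup>2))"
        unfolding nZ by (simp add: power2_eq_square)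
      ultimately show ?thesis using est(4)[OF \<zeta> le] by linarith
    qed
    then have "r (p + \<zeta> *s V + ?Z) < 0" using q sq or by linarith
    then have "p + \<zeta> *s V + ?Z \<in> D" using est(4)[OF \<zeta> le] mem_D_iff by blast
    then show ?thesis by (simp add: scaleR_complex_smult algebra_simps)
  qed
  let ?S = "(\<lambda>x. of_real x * c) ` {0..\<tau>}"
  have "p + 0 *s N + 0 *s V \<in> D"
  proof (rule cplane_disc_propagation[OF _ psc, of ?S \<rho> "of_real \<tau> * c"])
    show "cindep N V" using V N neg_line_nonzero by (intro cindep_transverse) (auto simp: neg_line_def)
    show "connected ?S" by (intro connected_continuous_image continuous_intros connected_Icc)
    show "0 \<in> ?S" using \<tau> by (auto intro!: image_eqI[of _ _ 0])
  qed (use est(3) \<tau> inD in auto)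
  then show False using p_notin_D by simp
qed

lemma cplane_base: "p \<in> cplane p N V"
proof -
  have "p = p + 0 *s N + 0 *s V" by simp
  then show ?thesis unfolding cplane_def by blast
qed

text \<open>The plane is spanned by \<open>V\<close> and a transverse vector: \<open>b - p\<close>
  itself if it is transverse, and any transverse vector if \<open>b\<close> lies on
  \<open>p + \<complex>V\<close>.\<close>

lemma nonpseudoconvex_section_through:
  assumes V: "neg_line V" and b: "b - p \<notin> T \<or> b - p = c *s V"
  obtains P where "complex_plane P" "p \<in> P" "b \<in> P" "\<not> pseudoconvex_in P (P \<inter> D)"
proof -
  obtain N0 where N0: "N0 \<notin> T" using normal_vector by metis
  define N where "N = (if b - p \<notin> T then b - p else N0)"
  have N: "N \<notin> T" using N0 by (simp add: N_def)
  have "b \<in> cplane p N V"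
  proof (cases "b - p \<in> T")
    case True
    then have "b = p + 0 *s N + c *s V" using b by (simp add: algebra_simps)
    then show ?thesis unfolding cplane_def by blast
  next
    case False
    then have "b = p + 1 *s N + 0 *s V" by (simp add: N_def)
    then show ?thesis unfolding cplane_def by blast
  qed
  moreover have "cindep N V" using V N neg_line_nonzero by (intro cindep_transverse) (auto simp: neg_line_def)
  ultimately show ?thesis
    by (intro that[of "cplane p N V"] complex_plane_cplane cplane_base transverse_plane_nonpseudoconvex[OF V N])
qed


section \<open>Zeros of the defining function on the tangent plane\<close>

lemma derivative_along_parabola:
  assumes z: "z \<in> U"
  shows "((\<lambda>s. r (z + s *\<^sub>R X + s\<^sup>2 *\<^sub>R Y)) has_real_derivative frechet_derivative r (at z) X) (at 0)"
proof -
  let ?d = "frechet_derivative r (at z)"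
  have d: "(r has_derivative ?d) (at (z + 0 *\<^sub>R X + 0\<^sup>2 *\<^sub>R Y))"
    using differentiable[OF z] frechet_derivative_works[of r "at z"] by simp
  have "((\<lambda>s. z + s *\<^sub>R X + s\<^sup>2 *\<^sub>R Y) has_derivative (\<lambda>s. s *\<^sub>R X)) (at 0)"
    by (auto intro!: derivative_eq_intros)
  from has_derivative_compose[OF this d]
  have "((\<lambda>s. r (z + s *\<^sub>R X + s\<^sup>2 *\<^sub>R Y)) has_derivative (\<lambda>s. ?d (s *\<^sub>R X))) (at 0)" .
  moreover have "(\<lambda>s. ?d (s *\<^sub>R X)) = (*) (?d X)"
    using linear_frechet_derivative_real[OF differentiable[OF z]] by (auto simp: linear_cmul)
  ultimately show ?thesis by (simp add: has_field_derivative_def)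
qed

text \<open>Every plane through \<open>a\<close> has a pseudoconvex section, so \<open>A\<close> and
  \<open>V\<close> may be tilted in the normal direction. Discs over the parameter 0, where the
  expansion at \<open>p\<close> decides, are compared with discs over \<open>t\<close>.
  \<open>step1\<close> gives the sign of \<open>r\<close>, \<open>step3\<close> excludes zeros off
  the line, and \<open>step2\<close> combines both with the existence of a zero over each
  \<open>t\<close>.\<close>

lemma zero_set_near:
  assumes V: "neg_line V" and a: "a \<notin> nonpsc_section_set D"
  defines "A \<equiv> a - p"
  obtains \<delta> where "\<delta> > 0" "A \<in> T" "cindep A V"
    "\<And>t \<zeta>. cmod t \<le> \<delta> \<Longrightarrow> cmod \<zeta> \<le> \<delta> \<Longrightarrow> p + t *s A + \<zeta> *s V \<in> U"
    "\<And>t \<zeta>. cmod t \<le> \<delta> \<Longrightarrow> cmod \<zeta> \<le> \<delta> \<Longrightarrow> r (p + t *s A + \<zeta> *s V) \<le> 0"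
    "\<And>t \<zeta>. cmod t \<le> \<delta> \<Longrightarrow> cmod \<zeta> \<le> \<delta> \<Longrightarrow> r (p + t *s A + \<zeta> *s V) = 0 \<longleftrightarrow> \<zeta> = 0"
proof -
  have psc: "pseudoconvex_in P (P \<inter> D)" if "complex_plane P" "a \<in> P" for P
    using a that unfolding nonpsc_section_set_def by blast
  have VT: "V \<in> T" using V by (simp add: neg_line_def)
  \<comment> \<open>If \<open>A\<close> were transverse or a multiple of \<open>V\<close>, then
    \<open>a\<close> would lie in a non-pseudoconvex section.\<close>
  have notb: "A \<in> T \<and> A \<noteq> c *s V" for c
    using nonpseudoconvex_section_through[OF V, of a c] psc unfolding A_def by metis
  then have AT: "A \<in> T" by blast
  have ind: "cindep A V"
    unfolding cindep_def
  proof (intro allI impI)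
    fix t \<zeta> assume eq: "t *s A + \<zeta> *s V = 0"
    have "t = 0"
    proof (rule ccontr)
      assume "t \<noteq> 0"
      then have "A = (- \<zeta> / t) *s V" using eq by (auto simp: vec_eq_iff field_simps eq_neg_iff_add_eq_0)
      then show False using notb by blast
    qed
    then show "t = 0 \<and> \<zeta> = 0" using eq neg_line_nonzero[OF V] by simp
  qed
  obtain N where N: "dr N = 1" "dr (\<i> *s N) = 0" "N \<notin> T" "\<And>c. dr (c *s N) = Re c"
    by (rule normal_vector) (rule that)
  obtain m C \<rho> where m: "m > 0" and C: "C > 0" and \<rho>: "\<rho> > 0"
    and est: "\<And>\<zeta> Z. cmod \<zeta> \<le> \<rho> \<Longrightarrow> norm Z \<le> \<rho> \<Longrightarrow>
      p + \<zeta> *s V + Z \<in> U \<and> r (p + \<zeta> *s V + Z) \<le> dr Z - m * (cmod \<zeta>)\<^sup>2 + C * (norm Z)\<^sup>2"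
    by (rule local_estimate[OF V]) (rule that)
  obtain K where K: "K > 0" "\<And>X. \<bar>dr X\<bar> \<le> K * norm X"
    using linear_bounded_pos[OF dr_linear] by auto
  \<comment> \<open>Continuity of the first derivatives keeps the outward derivative positive near
    \<open>p\<close>; \<open>step3\<close> needs this at a supposed zero of \<open>r\<close> other
    than \<open>p\<close>.\<close>
  obtain R where R: "R > 0" "\<And>z. dist z p < R \<Longrightarrow> z \<in> U \<and> frechet_derivative r (at z) N > 0"
  proof -
    have "continuous_on U (\<lambda>z. frechet_derivative r (at z) N)" using C1 by (simp add: C1_on_def)
    then have "((\<lambda>z. frechet_derivative r (at z) N) \<longlongrightarrow> 1) (at p)"
      using U N(1) by (metis continuous_on_eq_continuous_at isCont_def)
    then have "\<forall>\<^sub>F z in at p. frechet_derivative r (at z) N > 0"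
      by (rule order_tendstoD) simp
    then have "\<forall>\<^sub>F z in nhds p. frechet_derivative r (at z) N > 0"
      using N(1) unfolding eventually_at_filter by (auto elim!: eventually_mono)
    moreover have "\<forall>\<^sub>F z in nhds p. z \<in> U" using U by (rule eventually_nhds_in_open)
    ultimately have "\<forall>\<^sub>F z in nhds p. z \<in> U \<and> frechet_derivative r (at z) N > 0"
      by (rule eventually_conj[rotated])
    then show ?thesis using that unfolding eventually_nhds_metric by blast
  qed

  \<comment> \<open>Radii and tilted planes\<close>
  define v where "v = norm V"
  define \<delta> where "\<delta> = min \<rho> (R / 2 / (v + 1))"
  have v: "v \<ge> 0" "v + 1 > 0" by (auto simp: v_def add_nonneg_pos)
  have \<delta>: "\<delta> > 0" "\<delta> \<le> \<rho>" using \<rho> R(1) v by (auto simp: \<delta>_def)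
  have \<delta>v: "\<delta> * v < R / 2"
  proof -
    have "\<delta> * v < \<delta> * (v + 1)" using \<delta> by simp
    also have "\<dots> \<le> R / 2"
      by (rule iffD1[OF pos_le_divide_eq[OF v(2)]]) (simp add: \<delta>_def)
    finally show ?thesis .
  qed
  \<comment> \<open>\<open>\<eta>\<close> bounds the deviation \<open>Z\<close> from the disc in
    direction \<open>V\<close>. The last bound makes \<open>\<eta> * (K + C)\<close> smaller than
    the gain \<open>m * \<delta>^2\<close> on the circle, and \<open>\<eta> \<le> 1\<close> lets
    \<open>\<eta>\<close> dominate its square.\<close>
  define \<eta> where "\<eta> = Min {1, \<rho>, R / 2, m * \<delta>\<^sup>2 / (2 * (K + C))}"
  have \<eta>: "\<eta> > 0" "\<eta> \<le> 1" "\<eta> \<le> \<rho>" "\<eta> \<le> R / 2" "\<eta> \<le> m * \<delta>\<^sup>2 / (2 * (K + C))"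
  proof -
    show "\<eta> > 0" using \<rho> R(1) m \<delta> K(1) C by (simp add: \<eta>_def)
    have le: "\<eta> \<le> x" if "x \<in> {1, \<rho>, R / 2, m * \<delta>\<^sup>2 / (2 * (K + C))}" for x
      unfolding \<eta>_def by (rule Min_le[OF _ that]) simp
    show "\<eta> \<le> 1" "\<eta> \<le> \<rho>" "\<eta> \<le> R / 2" "\<eta> \<le> m * \<delta>\<^sup>2 / (2 * (K + C))"
      by (rule le, blast)+
  qed
  have \<eta>b: "\<eta> * (K + C) < m * \<delta>\<^sup>2"
  proof -
    have "2 * (K + C) > 0" using K(1) C by simp
    then have "\<eta> * (2 * (K + C)) \<le> m * \<delta>\<^sup>2" using \<eta>(5) by (rule iffD1[OF pos_le_divide_eq])
    moreover have "\<eta> * (K + C) > 0" using \<eta> K(1) C by simp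
    ultimately show ?thesis by linarith
  qed
  define n where "n = norm N"
  \<comment> \<open>\<open>\<tau>\<close> bounds \<open>t\<close> and \<open>\<sigma>\<close> bounds
    the coefficient of \<open>N\<close>; each of the two may contribute \<open>\<eta> / 2\<close> to
    the deviation.\<close>
  define \<tau> where "\<tau> = min \<delta> (\<eta> / 2 / (norm A + 1))"
  define \<sigma> where "\<sigma> = \<eta> / 2 / (n + 1)"
  have n: "n \<ge> 0" "n + 1 > 0" "norm A + 1 > 0" by (auto simp: n_def add_nonneg_pos)
  have \<tau>: "\<tau> > 0" "\<tau> \<le> \<delta>" using \<eta> \<delta> n by (auto simp: \<tau>_def)
  have \<sigma>: "\<sigma> > 0" using \<eta> n by (simp add: \<sigma>_def)
  have Zsmall: "norm (t *s A + s *s N) \<le> \<eta>" if "cmod t \<le> \<tau>" "cmod s \<le> \<sigma>" for t s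
  proof -
    have "cmod t * (norm A + 1) \<le> \<eta> / 2"
      using that(1) by (intro iffD1[OF pos_le_divide_eq[OF n(3)]]) (simp add: \<tau>_def)
    then have 1: "cmod t * norm A \<le> \<eta> / 2" using norm_ge_zero[of t] unfolding distrib_left mult_1_right by linarith
    have "cmod s * (n + 1) \<le> \<eta> / 2"
      using that(2) by (intro iffD1[OF pos_le_divide_eq[OF n(2)]]) (simp add: \<sigma>_def)
    then have 2: "cmod s * n \<le> \<eta> / 2" using norm_ge_zero[of s] unfolding distrib_left mult_1_right by linarith
    show ?thesis using norm_triangle_ineq[of "t *s A" "s *s N"] 1 2
      by (simp add: norm_complex_smult n_def)
  qed
  have near: "p + \<zeta> *s V + Z \<in> U \<and> frechet_derivative r (at (p + \<zeta> *s V + Z)) N > 0"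
    if "cmod \<zeta> \<le> \<delta>" "norm Z \<le> \<eta>" for \<zeta> Z
  proof -
    have "norm (\<zeta> *s V + Z) \<le> cmod \<zeta> * v + norm Z"
      using norm_triangle_ineq[of "\<zeta> *s V" Z] by (simp add: norm_complex_smult v_def)
    also have "\<dots> \<le> \<delta> * v + \<eta>" using that v by (intro add_mono mult_right_mono) auto
    also have "\<dots> < R" using \<delta>v \<eta>(4) by simp
    finally have "dist (p + \<zeta> *s V + Z) p < R" by (simp add: dist_norm add.assoc)
    then show ?thesis by (rule R(2))
  qed
  have circle: "p + \<zeta> *s V + Z \<in> D" if "cmod \<zeta> = \<delta>" "norm Z \<le> \<eta>" for \<zeta> Z
  proof -
    have e: "p + \<zeta> *s V + Z \<in> U \<and> r (p + \<zeta> *s V + Z) \<le> dr Z - m * (cmod \<zeta>)\<^sup>2 + C * (norm Z)\<^sup>2"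
      using that \<delta> \<eta> by (intro est) auto
    have "dr Z \<le> K * \<eta>" using K(2)[of Z] mult_left_mono[OF that(2), of K] K(1) by linarith
    moreover have "C * (norm Z)\<^sup>2 \<le> C * \<eta>"
    proof -
      have "(norm Z)\<^sup>2 \<le> \<eta>\<^sup>2" using that by (intro power_mono) auto
      also have "\<dots> \<le> \<eta>" using \<eta> by (simp add: power2_eq_square mult_left_le)
      finally show ?thesis using C by simp
    qed
    ultimately have "r (p + \<zeta> *s V + Z) \<le> \<eta> * (K + C) - m * \<delta>\<^sup>2"
      using e that(1) by (simp add: algebra_simps)
    then show ?thesis using e \<eta>b mem_D_iff by auto
  qed
  \<comment> \<open>These are the points of the plane through \<open>a\<close> with directions
    \<open>A + \<epsilon> *s N\<close> and \<open>V + \<mu> *s N\<close>. Since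
    \<open>a = p + A\<close>, the point \<open>a\<close> has parameter \<open>t = 1\<close>; this
    explains the factor \<open>t - 1\<close>, by which a positive \<open>\<epsilon>\<close> moves
    the disc over 0 inwards.\<close>
  define pt where "pt \<mu> \<epsilon> t \<zeta> = p + \<zeta> *s V + (t *s A + (\<mu> * \<zeta> + \<epsilon> * (t - 1)) *s N)" for \<mu> \<epsilon> t \<zeta>
  have sz: "norm (t *s A + (\<mu> * \<zeta> + \<epsilon> * (t - 1)) *s N) \<le> \<eta>"
    if "cmod \<mu> * \<delta> + cmod \<epsilon> * (\<tau> + 1) \<le> \<sigma>" "cmod t \<le> \<tau>" "cmod \<zeta> \<le> \<delta>" for \<mu> \<epsilon> t \<zeta>
  proof (rule Zsmall[OF that(2)])
    have "cmod (\<mu> * \<zeta> + \<epsilon> * (t - 1)) \<le> cmod \<mu> * cmod \<zeta> + cmod \<epsilon> * cmod (t - 1)"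
      using norm_triangle_ineq[of "\<mu> * \<zeta>" "\<epsilon> * (t - 1)"] by (simp add: norm_mult)
    also have "\<dots> \<le> cmod \<mu> * \<delta> + cmod \<epsilon> * (\<tau> + 1)"
      using that norm_triangle_ineq4[of t 1] by (intro add_mono mult_left_mono) auto
    finally show "cmod (\<mu> * \<zeta> + \<epsilon> * (t - 1)) \<le> \<sigma>" using that(1) by simp
  qed
  \<comment> \<open>All circles over the admissible \<open>t\<close> lie in \<open>D\<close> by
    \<open>circle\<close>, so one disc in \<open>D\<close> brings all the others with it.\<close>
  have propagate: "pt \<mu> \<epsilon> t \<zeta> \<in> D"
    if small: "cmod \<mu> * \<delta> + cmod \<epsilon> * (\<tau> + 1) \<le> \<sigma>"
      and t0: "cmod t0 \<le> \<tau>" "\<And>\<zeta>. cmod \<zeta> \<le> \<delta> \<Longrightarrow> pt \<mu> \<epsilon> t0 \<zeta> \<in> D"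
      and t: "cmod t \<le> \<tau>" "cmod \<zeta> \<le> \<delta>" for \<mu> \<epsilon> t0 t \<zeta>
  proof -
    have pt: "pt \<mu> \<epsilon> t \<zeta> = a + (t - 1) *s (A + \<epsilon> *s N) + \<zeta> *s (V + \<mu> *s N)" for t \<zeta>
      by (simp add: pt_def A_def vec_eq_iff algebra_simps)
    have ind': "cindep (A + \<epsilon> *s N) (V + \<mu> *s N)"
      unfolding cindep_def
    proof (intro allI impI)
      fix x y assume "x *s (A + \<epsilon> *s N) + y *s (V + \<mu> *s N) = 0"
      then have eq: "x *s A + y *s V = (- (x * \<epsilon> + y * \<mu>)) *s N"
        by (simp add: vec_eq_iff algebra_simps eq_neg_iff_add_eq_0)
      define k where "k = - (x * \<epsilon> + y * \<mu>)"
      have "x *s A + y *s V \<in> T"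
        using AT VT by (intro vec.subspace_add[OF T_subspace] vec.subspace_scale[OF T_subspace])
      moreover have eqk: "x *s A + y *s V = k *s N" unfolding k_def by (rule eq)
      ultimately have kT: "k *s N \<in> T" by simp
      have "k = 0"
      proof (rule ccontr)
        assume "k \<noteq> 0"
        then have "N = (1 / k) *s (k *s N)" by simp
        then show False using vec.subspace_scale[OF T_subspace kT] N(3) by metis
      qed
      then have "x *s A + y *s V = 0" using eqk by simp
      then show "x = 0 \<and> y = 0" using ind by (simp add: cindep_def)
    qed
    let ?P = "cplane a (A + \<epsilon> *s N) (V + \<mu> *s N)"
    have "a = a + 0 *s (A + \<epsilon> *s N) + 0 *s (V + \<mu> *s N)" by simp
    then have "a \<in> ?P" unfolding cplane_def by blast
    then have pP: "pseudoconvex_in ?P (?P \<inter> D)" by (rule psc[OF complex_plane_cplane[OF ind']])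
    have mem: "t - 1 \<in> cball (- 1) \<tau> \<longleftrightarrow> cmod t \<le> \<tau>" for t :: complex
      by (simp add: dist_norm norm_minus_commute)
    have "a + (t - 1) *s (A + \<epsilon> *s N) + \<zeta> *s (V + \<mu> *s N) \<in> D"
    proof (rule cplane_disc_propagation[OF ind' pP, of "cball (- 1) \<tau>" \<delta> "t0 - 1"])
      fix s \<xi> :: complex assume s: "s \<in> cball (- 1) \<tau>" "cmod \<xi> = \<delta>"
      have "cmod (s + 1) \<le> \<tau>" using mem[of "s + 1"] s by simp
      then have "pt \<mu> \<epsilon> (s + 1) \<xi> \<in> D" unfolding pt_def using s small by (intro circle sz) auto
      then show "a + s *s (A + \<epsilon> *s N) + \<xi> *s (V + \<mu> *s N) \<in> D" by (simp add: pt)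
    next
      show "connected (cball (- 1 :: complex) \<tau>)" by (intro convex_connected convex_cball)
      show "t0 - 1 \<in> cball (- 1) \<tau>" "t - 1 \<in> cball (- 1) \<tau>" using mem t0 t by auto
      show "a + (t0 - 1) *s (A + \<epsilon> *s N) + \<xi> *s (V + \<mu> *s N) \<in> D" if "cmod \<xi> \<le> \<delta>" for \<xi>
        using t0(2)[OF that] by (simp only: pt)
    qed (use \<delta> t in auto)
    then show ?thesis by (simp only: pt)
  qed

  \<comment> \<open>Signs of \<open>r\<close> over small parameters\<close>
  have pt0: "pt 0 0 t \<zeta> = p + t *s A + \<zeta> *s V" for t \<zeta>
    by (simp add: pt_def algebra_simps)
  have inU: "p + t *s A + \<zeta> *s V \<in> U" "frechet_derivative r (at (p + t *s A + \<zeta> *s V)) N > 0"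
    if "cmod t \<le> \<tau>" "cmod \<zeta> \<le> \<delta>" for t \<zeta>
  proof -
    have "norm (t *s A) \<le> \<eta>" using Zsmall[OF that(1), of 0] \<sigma> by simp
    from near[OF that(2) this] show "p + t *s A + \<zeta> *s V \<in> U" "frechet_derivative r (at (p + t *s A + \<zeta> *s V)) N > 0"
      by (simp_all add: algebra_simps)
  qed
  \<comment> \<open>For \<open>\<mu> = 0\<close> and small \<open>\<epsilon> > 0\<close> the disc
    over 0 is shifted by \<open>- \<epsilon>\<close> along \<open>N\<close> and lies in
    \<open>D\<close>, hence so does the disc over \<open>t\<close>. Letting
    \<open>\<epsilon>\<close> tend to 0 gives the weak inequality.\<close>
  have step1: "r (p + t *s A + \<zeta> *s V) \<le> 0" if t: "cmod t \<le> \<tau>" "cmod \<zeta> \<le> \<delta>" for t \<zeta>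
  proof -
    \<comment> \<open>The second bound makes the linear gain \<open>\<epsilon>\<close> outweigh the
      quadratic term \<open>C * (\<epsilon> * n)^2\<close>.\<close>
    define \<epsilon>0 where "\<epsilon>0 = min (\<sigma> / (\<tau> + 1)) (1 / (C * n\<^sup>2 + 1))"
    have Cn: "C * n\<^sup>2 + 1 > 0" using C by (auto intro: add_nonneg_pos)
    have e0: "\<epsilon>0 > 0" using \<sigma> \<tau> Cn by (simp add: \<epsilon>0_def)
    have neg: "r (pt 0 (of_real \<epsilon>) t \<zeta>) < 0" if e: "0 < \<epsilon>" "\<epsilon> < \<epsilon>0" for \<epsilon>
    proof -
      have "\<epsilon> < \<sigma> / (\<tau> + 1)" "\<epsilon> < 1 / (C * n\<^sup>2 + 1)" using e by (auto simp: \<epsilon>0_def)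
      moreover have "\<tau> + 1 > 0" using \<tau> by simp
      ultimately have "\<epsilon> * (\<tau> + 1) < \<sigma>" and ec: "\<epsilon> * (C * n\<^sup>2 + 1) < 1"
        using iffD1[OF pos_less_divide_eq[OF Cn]] iffD1[OF pos_less_divide_eq[OF \<open>\<tau> + 1 > 0\<close>]] by blast+
      then have es: "cmod 0 * \<delta> + cmod (of_real \<epsilon>) * (\<tau> + 1) \<le> \<sigma>"
        using e by simp
      have start: "pt 0 (of_real \<epsilon>) 0 \<xi> \<in> D" if xi: "cmod \<xi> \<le> \<delta>" for \<xi>
      proof -
        let ?Z = "(- complex_of_real \<epsilon>) *s N"
        have "norm ?Z \<le> \<eta>" using sz[OF es _ xi, of 0] \<tau> by simp
        then have "norm ?Z \<le> \<rho>" using \<eta> by simp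
        with xi \<delta> have E: "p + \<xi> *s V + ?Z \<in> U \<and> r (p + \<xi> *s V + ?Z) \<le> dr ?Z - m * (cmod \<xi>)\<^sup>2 + C * (norm ?Z)\<^sup>2"
          by (intro est) auto
        have "norm ?Z = \<epsilon> * n" unfolding norm_complex_smult n_def using e by simp
        then have "C * (norm ?Z)\<^sup>2 = \<epsilon> * (\<epsilon> * (C * n\<^sup>2))" by (simp only: power2_eq_square ac_simps)
        moreover have "\<epsilon> * (\<epsilon> * (C * n\<^sup>2)) < \<epsilon> * 1"
          using ec e by (intro mult_strict_left_mono) (auto simp: algebra_simps)
        moreover have "dr ?Z = - \<epsilon>" by (subst N(4)) simp
        moreover have "m * (cmod \<xi>)\<^sup>2 \<ge> 0" using m by simp
        ultimately have "r (p + \<xi> *s V + ?Z) < 0" using E by linarith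
        then have "p + \<xi> *s V + ?Z \<in> D" using E mem_D_iff by blast
        then show ?thesis by (simp add: pt_def)
      qed
      have "pt 0 (of_real \<epsilon>) t \<zeta> \<in> D"
        using \<tau> by (intro propagate[OF es _ start t]) auto
      moreover have "pt 0 (of_real \<epsilon>) t \<zeta> \<in> U"
        unfolding pt_def using near[OF t(2) sz[OF es t]] by blast
      ultimately show ?thesis using mem_D_iff by blast
    qed
    have pe: "pt 0 (of_real \<epsilon>) t \<zeta> = p + t *s A + \<zeta> *s V + \<epsilon> *\<^sub>R ((t - 1) *s N)" for \<epsilon>
      by (simp add: pt_def scaleR_complex_smult algebra_simps)
    have "isCont r (p + t *s A + \<zeta> *s V)"
      using differentiable[OF inU(1)[OF t]] by (rule differentiable_imp_continuous_within)
    moreover have "((\<lambda>\<epsilon>. p + t *s A + \<zeta> *s V + \<epsilon> *\<^sub>R ((t - 1) *s N)) \<longlongrightarrow>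
        p + t *s A + \<zeta> *s V + 0 *\<^sub>R ((t - 1) *s N)) (at_right 0)"
      by (intro tendsto_intros)
    ultimately have "((\<lambda>\<epsilon>. r (pt 0 (of_real \<epsilon>) t \<zeta>)) \<longlongrightarrow> r (p + t *s A + \<zeta> *s V)) (at_right 0)"
      unfolding pe by (intro isCont_tendsto_compose[of _ r]) auto
    moreover have "\<forall>\<^sub>F \<epsilon> in at_right 0. r (pt 0 (of_real \<epsilon>) t \<zeta>) \<le> 0"
      unfolding eventually_at_right_field using e0 neg by (intro exI[of _ \<epsilon>0]) (auto intro: less_imp_le)
    ultimately show ?thesis by (rule tendsto_upperbound) simp
  qed
  have step3: "\<zeta> = 0" if t: "cmod t \<le> \<tau>" "cmod \<zeta> \<le> \<delta>" and zero: "r (p + t *s A + \<zeta> *s V) = 0" for t \<zeta>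
  proof (rule ccontr)
    assume nz: "\<zeta> \<noteq> 0"
    let ?z = "p + t *s A + \<zeta> *s V"
    \<comment> \<open>In the tilted plane the zero moves along the curve with linear term
      \<open>X\<close> and quadratic term \<open>Y\<close>. As \<open>X\<close> points outwards,
      \<open>r\<close> would become positive for small \<open>s\<close>, but propagation from the
      disc over 0 makes it negative.\<close>
    define X Y where "X = cmod \<zeta> *\<^sub>R N" and "Y = (of_real (1 / m) * (t - 1)) *s N"
    define s0 where "s0 = Min {1, \<sigma> / (\<delta> + 1 / m * (\<tau> + 1)), m / (4 * C * n\<^sup>2 + 1)}"
    have pos: "\<delta> + 1 / m * (\<tau> + 1) > 0" "4 * C * n\<^sup>2 + 1 > 0"
      using \<delta> m \<tau> C by (auto intro!: add_pos_pos add_nonneg_pos)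
    have s0: "s0 > 0" using \<sigma> pos m by (simp add: s0_def)
    have neg: "r (?z + s *\<^sub>R X + s\<^sup>2 *\<^sub>R Y) < 0" if s: "0 < s" "s < s0" for s
    proof -
      \<comment> \<open>the tilt gains \<open>s * cmod \<zeta>\<close> at the zero, while the shift by \<open>s\<^sup>2 / m\<close> keeps the disc over \<open>0\<close> inside\<close>
      define \<mu> \<epsilon> where "\<mu> = of_real s * (cnj \<zeta> / cmod \<zeta>)" and "\<epsilon> = complex_of_real (s\<^sup>2 / m)"
      have "s < 1" "s < \<sigma> / (\<delta> + 1 / m * (\<tau> + 1))" "s < m / (4 * C * n\<^sup>2 + 1)"
        using s(2) unfolding s0_def by (simp_all only: Min_gr_iff finite.intros insert_not_empty ball_simps simp_thms)
      then have s': "s < 1" "s * (\<delta> + 1 / m * (\<tau> + 1)) < \<sigma>" "s * (4 * C * n\<^sup>2 + 1) < m"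
        using iffD1[OF pos_less_divide_eq[OF pos(1)]] iffD1[OF pos_less_divide_eq[OF pos(2)]] by blast+
      have c\<mu>: "cmod \<mu> = s" using s nz by (simp add: \<mu>_def norm_mult norm_divide)
      have c\<epsilon>: "cmod \<epsilon> = s\<^sup>2 / m" using m by (simp add: \<epsilon>_def norm_divide norm_power)
      have s2: "s\<^sup>2 \<le> s" using s s' by (simp add: power2_eq_square mult_left_le)
      have small: "cmod \<mu> * \<delta> + cmod \<epsilon> * (\<tau> + 1) \<le> \<sigma>"
      proof -
        have "s\<^sup>2 / m * (\<tau> + 1) \<le> s / m * (\<tau> + 1)"
          using s2 m \<tau> by (intro mult_right_mono divide_right_mono) auto
        then show ?thesis using s'(2) unfolding c\<mu> c\<epsilon> by (simp add: distrib_left)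
      qed
      have start: "pt \<mu> \<epsilon> 0 \<xi> \<in> D" if xi: "cmod \<xi> \<le> \<delta>" for \<xi>
      proof -
        define k where "k = \<mu> * \<xi> - \<epsilon>"
        let ?Z = "k *s N"
        define x where "x = cmod \<xi>"
        have "norm ?Z \<le> \<eta>" using sz[OF small _ xi, of 0] \<tau> by (simp add: k_def)
        then have "norm ?Z \<le> \<rho>" using \<eta> by simp
        with xi \<delta> have E: "p + \<xi> *s V + ?Z \<in> U \<and> r (p + \<xi> *s V + ?Z) \<le> dr ?Z - m * (cmod \<xi>)\<^sup>2 + C * (norm ?Z)\<^sup>2"
          by (intro est) auto
        have "Re (\<mu> * \<xi>) \<le> s * x"
          using complex_Re_le_cmod[of "\<mu> * \<xi>"] by (simp add: norm_mult c\<mu> x_def)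
        moreover have "dr ?Z = Re (\<mu> * \<xi>) - s\<^sup>2 / m"
          unfolding N(4) by (simp only: k_def \<epsilon>_def minus_complex.simps Re_complex_of_real)
        ultimately have dZ: "dr ?Z \<le> s * x - s\<^sup>2 / m" by simp
        \<comment> \<open>The tilt uses up half of \<open>m * x^2\<close> and half of
          \<open>s^2 / m\<close>; the other halves absorb \<open>C * (norm ?Z)^2\<close>.\<close>
        have amgm: "s * x \<le> m / 2 * x\<^sup>2 + s\<^sup>2 / (2 * m)"
        proof -
          have "0 \<le> (m * x - s)\<^sup>2 / (2 * m)" using m by simp
          also have "\<dots> = m / 2 * x\<^sup>2 + s\<^sup>2 / (2 * m) - s * x"
            using m by (simp add: field_simps power2_eq_square)
          finally show ?thesis by linarith
        qed
        have "cmod k \<le> s * x + s\<^sup>2 / m"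
          using norm_triangle_ineq4[of "\<mu> * \<xi>" \<epsilon>] by (simp add: k_def norm_mult c\<mu> c\<epsilon> x_def)
        then have "(cmod k)\<^sup>2 \<le> (s * x + s\<^sup>2 / m)\<^sup>2" by (intro power_mono) auto
        also have "\<dots> \<le> 2 * (s * x)\<^sup>2 + 2 * (s\<^sup>2 / m)\<^sup>2"
          using sum_squares_bound[of "s * x" "s\<^sup>2 / m"] by (simp add: power2_sum)
        finally have "C * n\<^sup>2 * (cmod k)\<^sup>2 \<le> C * n\<^sup>2 * (2 * (s * x)\<^sup>2 + 2 * (s\<^sup>2 / m)\<^sup>2)"
          using C by (intro mult_left_mono) auto
        also have "\<dots> = (4 * C * n\<^sup>2 * s\<^sup>2) * (x\<^sup>2 / 2 + s\<^sup>2 / (2 * m\<^sup>2))"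
          by (simp add: algebra_simps power_mult_distrib power_divide)
        also have "\<dots> < m * (x\<^sup>2 / 2 + s\<^sup>2 / (2 * m\<^sup>2))"
        proof (rule mult_strict_right_mono)
          have "4 * C * n\<^sup>2 * s\<^sup>2 \<le> 4 * C * n\<^sup>2 * s" using s2 C by (intro mult_left_mono) auto
          also have "\<dots> < m" using s'(3) s by (simp add: algebra_simps)
          finally show "4 * C * n\<^sup>2 * s\<^sup>2 < m" .
          show "0 < x\<^sup>2 / 2 + s\<^sup>2 / (2 * m\<^sup>2)" using s m by (intro add_nonneg_pos) auto
        qed
        also have "\<dots> = m / 2 * x\<^sup>2 + s\<^sup>2 / (2 * m)" using m by (simp add: field_simps power2_eq_square)
        finally have "C * (norm ?Z)\<^sup>2 < m / 2 * x\<^sup>2 + s\<^sup>2 / (2 * m)"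
          by (simp add: norm_complex_smult n_def power_mult_distrib ac_simps)
        moreover have "s\<^sup>2 / m = 2 * (s\<^sup>2 / (2 * m))" "m * (cmod \<xi>)\<^sup>2 = 2 * (m / 2 * x\<^sup>2)"
          by (simp_all add: x_def)
        ultimately have "r (p + \<xi> *s V + ?Z) < 0" using E dZ amgm by linarith
        then have "p + \<xi> *s V + ?Z \<in> D" using E mem_D_iff by blast
        then show ?thesis by (simp add: pt_def k_def)
      qed
      have "pt \<mu> \<epsilon> t \<zeta> \<in> D"
        using \<tau> by (intro propagate[OF small _ start t]) auto
      moreover have "pt \<mu> \<epsilon> t \<zeta> \<in> U"
        unfolding pt_def using near[OF t(2) sz[OF small t]] by blast
      ultimately have "r (pt \<mu> \<epsilon> t \<zeta>) < 0" using mem_D_iff by blast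
      moreover have "\<mu> * \<zeta> = of_real (s * cmod \<zeta>)"
        using nz by (simp add: \<mu>_def complex_norm_square[symmetric] power2_eq_square field_simps)
      then have "pt \<mu> \<epsilon> t \<zeta> = ?z + s *\<^sub>R X + s\<^sup>2 *\<^sub>R Y"
        by (simp add: pt_def X_def Y_def \<epsilon>_def scaleR_complex_smult algebra_simps)
      ultimately show ?thesis by simp
    qed
    have "frechet_derivative r (at ?z) X > 0"
      using inU(2)[OF t] nz linear_frechet_derivative_real[OF differentiable[OF inU(1)[OF t]]]
      by (simp add: X_def linear_cmul)
    \<comment> \<open>The quadratic displacement \<open>Y\<close> does not affect the derivative at
      parameter 0.\<close>
    from DERIV_pos_inc_right[OF derivative_along_parabola[OF inU(1)[OF t]] this, of Y]
    obtain d where d: "d > 0" "\<And>h. h > 0 \<Longrightarrow> h < d \<Longrightarrow> r ?z < r (?z + h *\<^sub>R X + h\<^sup>2 *\<^sub>R Y)"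
      by auto
    define h where "h = min d s0 / 2"
    have "h > 0" "h < d" "h < s0" using d(1) s0 by (auto simp: h_def)
    then show False using d(2)[of h] neg[of h] zero by auto
  qed
  \<comment> \<open>otherwise the plane \<open>T\<^sub>p\<close> itself would give \<open>p \<in> D\<close>\<close>
  have step2: "r (p + t *s A) = 0" if t: "cmod t \<le> \<tau>" for t
  proof -
    have s0: "cmod 0 * \<delta> + cmod 0 * (\<tau> + 1) \<le> \<sigma>" using \<sigma> by simp
    have "\<exists>\<zeta>. cmod \<zeta> \<le> \<delta> \<and> pt 0 0 t \<zeta> \<notin> D"
    proof (rule ccontr)
      assume "\<not> ?thesis"
      then have "pt 0 0 t \<zeta> \<in> D" if "cmod \<zeta> \<le> \<delta>" for \<zeta> using that by blast
      then have "pt 0 0 0 0 \<in> D" by (rule propagate[OF s0 t]) (use \<tau> \<delta> in simp_all)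
      then show False using p_notin_D by (simp add: pt0)
    qed
    \<comment> \<open>By \<open>step1\<close> such a point outside \<open>D\<close> is a zero of
      \<open>r\<close>, and \<open>step3\<close> forces it to be the centre of the disc.\<close>
    then obtain \<zeta> where \<zeta>: "cmod \<zeta> \<le> \<delta>" "p + t *s A + \<zeta> *s V \<notin> D" by (auto simp: pt0)
    then have "r (p + t *s A + \<zeta> *s V) = 0"
      using step1[OF t \<zeta>(1)] mem_D_iff[OF inU(1)[OF t \<zeta>(1)]] by linarith
    then show ?thesis using step3[OF t \<zeta>(1)] by simp
  qed
  show ?thesis
  proof (rule that[of \<tau>])
    fix t \<zeta> assume t: "cmod t \<le> \<tau>" "cmod \<zeta> \<le> \<tau>"
    then have z: "cmod \<zeta> \<le> \<delta>" using \<tau> by simp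
    show "p + t *s A + \<zeta> *s V \<in> U" by (rule inU(1)[OF t(1) z])
    show "r (p + t *s A + \<zeta> *s V) \<le> 0" by (rule step1[OF t(1) z])
    show "r (p + t *s A + \<zeta> *s V) = 0 \<longleftrightarrow> \<zeta> = 0"
      using step3[OF t(1) z] step2[OF t(1)] by auto
  qed (use \<tau> AT ind in auto)
qed

end

section \<open>Complex linear algebra and the tangent space\<close>

lemma levi_form_smult: "levi_form r p (c *s X) (d *s Y) = c * cnj d * levi_form r p X Y"
  unfolding levi_form_def by (simp add: sum_distrib_left algebra_simps)

lemma hermitian_norm: "(\<Sum>j\<in>UNIV. X $ j * cnj (X $ j)) = of_real ((norm X)\<^sup>2)" for X :: "complex^'n"
proof -
  have "(norm X)\<^sup>2 = (\<Sum>j\<in>UNIV. (cmod (X $ j))\<^sup>2)"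
    by (simp add: norm_vec_def L2_set_def sum_nonneg)
  then show ?thesis by (simp only: of_real_sum complex_norm_square)
qed

lemma dim_span_singleton: "vec.dim (vec.span {x}) = (if x = 0 then 0 else 1)" for x :: "complex^'n"
proof (cases "x = 0")
  case False
  then have "vec.independent {x}" by simp
  then show ?thesis using False by (simp add: vec.dim_eq_card_independent)
qed (simp add: vec.dim_insert)

lemma linear_complex_pair_map:
  fixes A V :: "complex^'n"
  shows "linear (\<lambda>(t, \<zeta>). t *s A + \<zeta> *s V)"
  by (rule linearI) (auto simp: vec_eq_iff complex_eq_iff algebra_simps)

lemma inj_complex_pair_map:
  assumes "cindep A V"
  shows "inj (\<lambda>(t, \<zeta>). t *s A + \<zeta> *s V)"
proof (subst linear_injective_0[OF linear_complex_pair_map], intro allI impI)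
  fix x :: "complex \<times> complex" assume "(case x of (t, \<zeta>) \<Rightarrow> t *s A + \<zeta> *s V) = 0"
  then show "x = 0" using assms by (cases x) (auto simp: cindep_def zero_prod_def)
qed

context boundary_point
begin

text \<open>\<open>T\<close> is orthogonal to the gradient \<open>g\<close> of \<open>r\<close> and
  to \<open>\<i> *s g\<close>, which are nonzero and orthogonal to each other.\<close>

lemma dim_T: "dim T + 2 \<le> 2 * CARD('n)"
proof -
  define g where "g = adjoint dr 1"
  have g: "g \<bullet> X = dr X" for X
    using adjoint_works[OF dr_linear, of X 1] by (simp add: g_def inner_commute)
  have g0: "g \<noteq> 0" using grad g by (metis inner_zero_left)
  have orth: "orthogonal g (\<i> *s g)" unfolding orthogonal_def by (subst inner_commute) simp
  have ig0: "\<i> *s g \<noteq> 0" using g0 by simp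
  have ne: "g \<noteq> \<i> *s g" using orth g0 by (metis orthogonal_self)
  have "independent {g, \<i> *s g}"
    using orth g0 ig0 by (intro pairwise_orthogonal_independent) (auto simp: pairwise_def orthogonal_commute)
  then have d2: "dim (span {g, \<i> *s g}) = 2"
    using ne by (simp add: dim_eq_card_independent)
  have "T \<subseteq> {y \<in> UNIV. \<forall>x\<in>span {g, \<i> *s g}. orthogonal x y}"
  proof clarsimp
    fix y x assume y: "y \<in> T" and x: "x \<in> span {g, \<i> *s g}"
    show "orthogonal x y"
    proof (rule orthogonal_commute[THEN iffD1], rule orthogonal_to_span[OF x])
      fix z assume "z \<in> {g, \<i> *s g}"
      then show "orthogonal y z"
        using y g[of y] g[of "\<i> *s y"] inner_i_smult[of g y]
        by (auto simp: orthogonal_def T_iff inner_commute)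
    qed
  qed
  then have "dim T \<le> dim {y \<in> UNIV. \<forall>x\<in>span {g, \<i> *s g}. orthogonal x y}" by (rule dim_subset)
  moreover have "dim {y \<in> UNIV. \<forall>x\<in>span {g, \<i> *s g}. orthogonal x y} + dim (span {g, \<i> *s g})
      = dim (UNIV :: (complex^'n) set)"
    by (rule dim_subspace_orthogonal_to_vectors) auto
  ultimately show ?thesis using d2 by simp
qed

text \<open>Along \<open>T\<close> the constant and linear terms of the expansion vanish, so signs
  of \<open>r\<close> near \<open>p\<close> pass to the Hessian in the limit.\<close>

lemma hessian_limit:
  assumes "X \<in> T"
  shows "((\<lambda>s. 2 * r (p + s *\<^sub>R X) / s\<^sup>2) \<longlongrightarrow> H X X) (at_right 0)"
proof (rule tendstoI)
  fix e :: real assume e: "e > 0"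
  define q where "q = (norm X)\<^sup>2 + 1"
  define e' where "e' = e / 2 / q"
  have q: "q > 0" by (simp add: q_def add_nonneg_pos)
  have e': "e' > 0" using e q by (simp add: e'_def)
  have e'q: "2 * (e' * (norm X)\<^sup>2) < e"
  proof -
    have "e' * q = e / 2" using q by (simp add: e'_def)
    then have "e' * (norm X)\<^sup>2 + e' = e / 2" by (simp add: q_def distrib_left)
    then show ?thesis using e' by linarith
  qed
  obtain d where d: "d > 0" "\<And>h. norm h < d \<Longrightarrow> \<bar>r (p + h) - r p - dr h - H h h / 2\<bar> \<le> e' * (norm h)\<^sup>2"
    by (rule taylor_hessian[OF twice e']) (rule that)
  have n1: "norm X + 1 > 0" by (simp add: add_nonneg_pos)
  have "dist (2 * r (p + s *\<^sub>R X) / s\<^sup>2) (H X X) < e" if s: "0 < s" "s < d / (norm X + 1)" for s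
  proof -
    have "s * (norm X + 1) < d" using s(2) by (rule iffD1[OF pos_less_divide_eq[OF n1]])
    then have small: "norm (s *\<^sub>R X) < d" using s by (simp add: distrib_left)
    have "dr (s *\<^sub>R X) = 0" using assms by (simp add: linear_cmul[OF dr_linear] T_iff)
    moreover have "H (s *\<^sub>R X) (s *\<^sub>R X) = s\<^sup>2 * H X X"
      by (simp add: bilinear_lmul[OF H_bilinear] bilinear_rmul[OF H_bilinear] power2_eq_square)
    ultimately have "\<bar>r (p + s *\<^sub>R X) - s\<^sup>2 * H X X / 2\<bar> \<le> e' * (norm (s *\<^sub>R X))\<^sup>2"
      using d(2)[OF small] r_p by (simp only: diff_zero)
    then have b: "\<bar>r (p + s *\<^sub>R X) - s\<^sup>2 * H X X / 2\<bar> \<le> s\<^sup>2 * (e' * (norm X)\<^sup>2)"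
      using s by (simp add: power_mult_distrib mult.commute mult.left_commute)
    have "2 * r (p + s *\<^sub>R X) / s\<^sup>2 - H X X = 2 * (r (p + s *\<^sub>R X) - s\<^sup>2 * H X X / 2) / s\<^sup>2"
      using s by (simp add: diff_divide_distrib right_diff_distrib)
    then have "dist (2 * r (p + s *\<^sub>R X) / s\<^sup>2) (H X X) = 2 * \<bar>r (p + s *\<^sub>R X) - s\<^sup>2 * H X X / 2\<bar> / s\<^sup>2"
      unfolding dist_real_def by (simp only: abs_divide abs_mult abs_power2 abs_numeral)
    also have "\<dots> \<le> 2 * (s\<^sup>2 * (e' * (norm X)\<^sup>2)) / s\<^sup>2"
      using b by (intro divide_right_mono mult_left_mono) auto
    also have "\<dots> = 2 * (e' * (norm X)\<^sup>2)" using s by simp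
    finally show ?thesis using e'q by simp
  qed
  moreover have "d / (norm X + 1) > 0" using d(1) n1 by simp
  ultimately show "\<forall>\<^sub>F s in at_right 0. dist (2 * r (p + s *\<^sub>R X) / s\<^sup>2) (H X X) < e"
    unfolding eventually_at_right_field by (intro exI[of _ "d / (norm X + 1)"]) auto
qed

text \<open>The zeros provided by \<open>zero_set_near\<close> form the line in direction
  \<open>A\<close>. On \<open>T\<close> the Hessian is non-positive and vanishes along
  \<open>\<complex>A\<close>, so this real plane lies in its kernel. The eigenvalues of the Hessian,
  the directions that may replace \<open>V\<close>, and the Levi form are read off from
  this.\<close>

lemma nonpsc_sections:
  assumes dimT: "dim T \<le> 4" and eig: "eigenvalues_on T H {#\<kappa>1, \<kappa>2, \<kappa>3, \<kappa>4#}"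
    and \<kappa>: "\<kappa>1 < 0" "\<kappa>2 < 0" "\<kappa>3 \<le> 0" and S: "nonpsc_section_set D \<noteq> UNIV"
  shows "\<exists>l. complex_line l \<and> p \<in> l \<and>
    (subset_near p (tangent_hyperplane r p - l) D \<and>
     subset_near p l (frontier D) \<and>
     UNIV - l \<subseteq> nonpsc_section_set D) \<and>
    ((\<forall>b. b \<notin> l \<or> b = p \<longrightarrow>
        (\<exists>P. complex_plane P \<and> p \<in> P \<and> b \<in> P \<and> \<not> pseudoconvex_in P (P \<inter> D))) \<and>
     p \<in> nonpsc_section_set D \<and>
     (\<forall>b. b \<in> l \<and> b \<noteq> p \<longrightarrow>
        \<not> (\<exists>P. complex_plane P \<and> p \<in> P \<and> b \<in> P \<and> \<not> pseudoconvex_in P (P \<inter> D)))) \<and>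
    ((\<forall>X. p + X \<in> l \<longrightarrow> H X X = 0 \<and> levi_form r p X X = 0) \<and>
     (\<exists>\<mu>1 \<mu>2. \<mu>1 < 0 \<and> \<mu>2 < 0 \<and> eigenvalues_on T H {#\<mu>1, \<mu>2, 0, 0#}) \<and>
     (\<exists>\<nu>. \<nu> < 0 \<and> hermitian_eigenvalues_on T (levi_form r p) {#\<nu>, 0#}))"
proof -
  have Tsc: "c *s X \<in> T" if "X \<in> T" for c X using vec.subspace_scale[OF T_subspace that] .
  have Tad: "X + Y \<in> T" if "X \<in> T" "Y \<in> T" for X Y using vec.subspace_add[OF T_subspace that] .
  have T_real: "subspace T"
    unfolding subspace_def using Tsc Tad vec.subspace_0[OF T_subspace] by (auto simp: scaleR_complex_smult)
  have sym: "H X Y = H Y X" for X Y by (rule hessian_commute[OF twice])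
  note Ha = bilinear_ladd[OF H_bilinear] bilinear_radd[OF H_bilinear]
  note Hs = Ha bilinear_lmul[OF H_bilinear] bilinear_rmul[OF H_bilinear]
  obtain V where V: "neg_line V"
    by (rule neg_definite_complex_line[OF T_subspace H_bilinear sym eig dimT \<kappa>])
       (auto simp: neg_line_def)
  then have VT: "V \<in> T" by (simp add: neg_line_def)
  obtain a where a: "a \<notin> nonpsc_section_set D" using S by blast
  define A where "A = a - p"
  obtain \<delta> where \<delta>: "\<delta> > 0" and AT: "A \<in> T" and ind: "cindep A V"
    and inU: "\<And>t \<zeta>. cmod t \<le> \<delta> \<Longrightarrow> cmod \<zeta> \<le> \<delta> \<Longrightarrow> p + t *s A + \<zeta> *s V \<in> U"
    and le0: "\<And>t \<zeta>. cmod t \<le> \<delta> \<Longrightarrow> cmod \<zeta> \<le> \<delta> \<Longrightarrow> r (p + t *s A + \<zeta> *s V) \<le> 0"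
    and eq0: "\<And>t \<zeta>. cmod t \<le> \<delta> \<Longrightarrow> cmod \<zeta> \<le> \<delta> \<Longrightarrow> r (p + t *s A + \<zeta> *s V) = 0 \<longleftrightarrow> \<zeta> = 0"
    by (rule zero_set_near[OF V a, folded A_def]) (rule that)
  have A0: "A \<noteq> 0"
  proof
    assume "A = 0"
    then have "1 *s A + 0 *s V = 0" by simp
    then show False using ind unfolding cindep_def by (metis zero_neq_one)
  qed

  \<comment> \<open>Linear coordinates on the tangent space\<close>
  let ?f = "\<lambda>(t, \<zeta>). t *s A + \<zeta> *s V"
  \<comment> \<open>\<open>\<beta>\<close> bounds the coordinates by the distance from
    \<open>p\<close>; it determines the ball used in \<open>i1\<close> and
    \<open>i2\<close>.\<close>
  obtain \<beta> where \<beta>: "\<beta> > 0" "\<And>x. \<beta> * norm x \<le> norm (?f x)"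
    using linear_inj_bounded_below_pos[OF linear_complex_pair_map inj_complex_pair_map[OF ind]] by metis
  \<comment> \<open>The image of the injective map \<open>?f\<close> has real dimension 4, which is
    at least \<open>dim T\<close>.\<close>
  have "range ?f = T"
  proof (rule subspace_dim_equal)
    show "subspace (range ?f)" by (intro linear_subspace_image linear_complex_pair_map) simp
    show "range ?f \<subseteq> T" using AT VT by (auto intro!: Tad Tsc)
    have "dim (range ?f) = dim (UNIV :: (complex \<times> complex) set)"
      using inj_complex_pair_map[OF ind] by (intro dim_image_eq linear_complex_pair_map) (simp add: span_UNIV)
    then show "dim (range ?f) \<ge> dim T" using dimT by simp
  qed (rule T_real)
  then have T_eq: "\<exists>t \<zeta>. X = t *s A + \<zeta> *s V" if "X \<in> T" for X
    using that by (metis (no_types, lifting) imageE case_prod_conv old.prod.exhaust)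

  \<comment> \<open>Sign and kernel of the Hessian\<close>
  have ev: "\<forall>\<^sub>F s in at_right (0::real). cmod (of_real s * t) \<le> \<delta>" for t
  proof -
    have "((\<lambda>s::real. cmod (of_real s * t)) \<longlongrightarrow> cmod (of_real 0 * t)) (at_right 0)"
      by (intro tendsto_intros)
    then have "\<forall>\<^sub>F s in at_right (0::real). cmod (of_real s * t) < \<delta>"
      by (rule order_tendstoD) (use \<delta> in simp)
    then show ?thesis by (rule eventually_mono) simp
  qed
  have psc_eq: "p + s *\<^sub>R (t *s A + \<zeta> *s V) = p + (of_real s * t) *s A + (of_real s * \<zeta>) *s V" for s t \<zeta>
    by (simp add: vec_eq_iff complex_eq_iff algebra_simps)
  have H_le: "H X X \<le> 0" if "X \<in> T" for X
  proof -
    obtain t \<zeta> where X: "X = t *s A + \<zeta> *s V" using T_eq[OF \<open>X \<in> T\<close>] by blast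
    have "\<forall>\<^sub>F s in at_right 0. 2 * r (p + s *\<^sub>R X) / s\<^sup>2 \<le> 0"
      using ev[of t] ev[of \<zeta>] unfolding X psc_eq
      by eventually_elim (auto intro!: divide_nonpos_nonneg dest: le0)
    with hessian_limit[OF \<open>X \<in> T\<close>] show ?thesis by (rule tendsto_upperbound) simp
  qed
  have H_A: "H (t *s A) (t *s A) = 0" for t
  proof -
    have "\<forall>\<^sub>F s in at_right 0. 2 * r (p + s *\<^sub>R (t *s A + 0 *s V)) / s\<^sup>2 \<ge> 0"
      using ev[of t] ev[of 0] unfolding psc_eq
    proof eventually_elim
      case (elim s)
      have "r (p + (of_real s * t) *s A + (of_real s * 0) *s V) = 0"
        unfolding eq0[OF elim] by simp
      then show ?case by simp
    qed
    with hessian_limit[of "t *s A + 0 *s V"] have "H (t *s A + 0 *s V) (t *s A + 0 *s V) \<ge> 0"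
      using Tsc[OF AT] by (intro tendsto_lowerbound) auto
    then show ?thesis using H_le[OF Tsc[OF AT, of t]] by simp
  qed

  obtain e1 e2 e3 e4 where e: "{e1, e2, e3, e4} \<subseteq> T"
    and n: "norm e1 = 1" "norm e2 = 1" "norm e3 = 1" "norm e4 = 1"
    and o: "e1 \<bullet> e2 = 0" "e1 \<bullet> e3 = 0" "e1 \<bullet> e4 = 0" "e2 \<bullet> e3 = 0" "e2 \<bullet> e4 = 0" "e3 \<bullet> e4 = 0"
    and ex: "\<And>X. X \<in> T \<Longrightarrow> X = (X \<bullet> e1) *\<^sub>R e1 + (X \<bullet> e2) *\<^sub>R e2 + (X \<bullet> e3) *\<^sub>R e3 + (X \<bullet> e4) *\<^sub>R e4"
    and He: "\<And>Y. Y \<in> T \<Longrightarrow> H e1 Y = \<kappa>1 * (e1 \<bullet> Y)" "\<And>Y. Y \<in> T \<Longrightarrow> H e2 Y = \<kappa>2 * (e2 \<bullet> Y)"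
      "\<And>Y. Y \<in> T \<Longrightarrow> H e3 Y = \<kappa>3 * (e3 \<bullet> Y)" "\<And>Y. Y \<in> T \<Longrightarrow> H e4 Y = \<kappa>4 * (e4 \<bullet> Y)"
    by (rule eigenvalues_on_four[OF T_real H_bilinear sym eig dimT]) (rule that)
  have HXY: "H X Y = \<kappa>1 * (X \<bullet> e1) * (Y \<bullet> e1) + \<kappa>2 * (X \<bullet> e2) * (Y \<bullet> e2)
      + \<kappa>3 * (X \<bullet> e3) * (Y \<bullet> e3) + \<kappa>4 * (X \<bullet> e4) * (Y \<bullet> e4)" if "X \<in> T" "Y \<in> T" for X Y
  proof -
    have "H X Y = H ((X \<bullet> e1) *\<^sub>R e1 + (X \<bullet> e2) *\<^sub>R e2 + (X \<bullet> e3) *\<^sub>R e3 + (X \<bullet> e4) *\<^sub>R e4) Y"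
      using ex[OF that(1)] by simp
    then show ?thesis using that He by (simp add: Hs inner_commute algebra_simps)
  qed
  have "H e4 e4 = \<kappa>4" using He(4)[of e4] e n(4) by (simp add: norm_eq_1)
  then have k4: "\<kappa>4 \<le> 0" using H_le[of e4] e by simp
  \<comment> \<open>All four eigenvalues are now non-positive, so every term in the diagonal
    expansion of a null vector vanishes.\<close>
  have comp: "\<kappa>1 * ((t *s A) \<bullet> e1) = 0" "\<kappa>2 * ((t *s A) \<bullet> e2) = 0"
    "\<kappa>3 * ((t *s A) \<bullet> e3) = 0" "\<kappa>4 * ((t *s A) \<bullet> e4) = 0" for t
  proof -
    let ?X = "t *s A"
    have le: "\<kappa>1 * (?X \<bullet> e1)\<^sup>2 \<le> 0" "\<kappa>2 * (?X \<bullet> e2)\<^sup>2 \<le> 0" "\<kappa>3 * (?X \<bullet> e3)\<^sup>2 \<le> 0" "\<kappa>4 * (?X \<bullet> e4)\<^sup>2 \<le> 0"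
      using \<kappa> k4 by (auto intro!: mult_nonpos_nonneg)
    have "\<kappa>1 * (?X \<bullet> e1)\<^sup>2 + \<kappa>2 * (?X \<bullet> e2)\<^sup>2 + \<kappa>3 * (?X \<bullet> e3)\<^sup>2 + \<kappa>4 * (?X \<bullet> e4)\<^sup>2 = 0"
      using HXY[OF Tsc[OF AT] Tsc[OF AT], of t t] H_A[of t] by (simp add: power2_eq_square)
    then have "\<kappa>1 * (?X \<bullet> e1)\<^sup>2 = 0" "\<kappa>2 * (?X \<bullet> e2)\<^sup>2 = 0" "\<kappa>3 * (?X \<bullet> e3)\<^sup>2 = 0" "\<kappa>4 * (?X \<bullet> e4)\<^sup>2 = 0"
      using le by linarith+
    then show "\<kappa>1 * (?X \<bullet> e1) = 0" "\<kappa>2 * (?X \<bullet> e2) = 0" "\<kappa>3 * (?X \<bullet> e3) = 0" "\<kappa>4 * (?X \<bullet> e4) = 0"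
      by auto
  qed
  \<comment> \<open>\<open>A\<close> and \<open>\<i> *s A\<close> are nonzero and orthogonal over
    the reals, so they do not fit into one real line. Hence components along both \<open>e3\<close>
    and \<open>e4\<close> occur, which makes \<open>\<kappa>3\<close> and \<open>\<kappa>4\<close>
    vanish.\<close>
  have two: "\<not> (\<forall>t. (t *s A) = ((t *s A) \<bullet> e) *\<^sub>R e)" for e
  proof
    assume all: "\<forall>t. (t *s A) = ((t *s A) \<bullet> e) *\<^sub>R e"
    have 1: "A = (A \<bullet> e) *\<^sub>R e" using all[rule_format, of 1] by simp
    have 2: "\<i> *s A = ((\<i> *s A) \<bullet> e) *\<^sub>R e" using all by blast
    have "0 = ((\<i> *s A) \<bullet> e) * ((A \<bullet> e) * (e \<bullet> e))"
      using inner_i_smult_self[of A] by (subst (asm) 2, subst (asm) 1) (simp add: ac_simps)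
    then have "(\<i> *s A) \<bullet> e = 0 \<or> A \<bullet> e = 0 \<or> e = 0" by auto
    then have "\<i> *s A = 0 \<or> A = 0" using 1 2 by (metis scaleR_zero_left scaleR_zero_right)
    then show False using A0 by simp
  qed
  have exA: "t *s A = ((t *s A) \<bullet> e3) *\<^sub>R e3 + ((t *s A) \<bullet> e4) *\<^sub>R e4" for t
    using ex[OF Tsc[OF AT, of t]] comp(1,2)[of t] \<kappa> by simp
  have k3: "\<kappa>3 = 0"
  proof (rule ccontr)
    assume "\<kappa>3 \<noteq> 0"
    then have "t *s A = ((t *s A) \<bullet> e4) *\<^sub>R e4" for t using exA[of t] comp(3)[of t] by simp
    then show False using two by blast
  qed
  have k4: "\<kappa>4 = 0"
  proof (rule ccontr)
    assume "\<kappa>4 \<noteq> 0"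
    then have "t *s A = ((t *s A) \<bullet> e3) *\<^sub>R e3" for t using exA[of t] comp(4)[of t] by simp
    then show False using two by blast
  qed
  have ker: "H (t *s A) Y = 0" "H Y (t *s A) = 0" if "Y \<in> T" for t Y
    using HXY[OF Tsc[OF AT] that, of t] comp[of t] sym[of Y "t *s A"] by auto
  \<comment> \<open>Modulo the kernel of the Hessian, a tangent vector outside
    \<open>\<complex>A\<close> is a nonzero complex multiple of \<open>V\<close>.\<close>
  have neg: "neg_line X" if XT: "X \<in> T" and notA: "\<And>t. X \<noteq> t *s A" for X
    unfolding neg_line_def
  proof (intro conjI allI impI XT)
    fix c :: complex assume c: "c \<noteq> 0"
    obtain t \<zeta> where X: "X = t *s A + \<zeta> *s V" using T_eq[OF XT] by blast
    then have "\<zeta> \<noteq> 0" using notA[of t] by auto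
    have "c *s X = (c * t) *s A + (c * \<zeta>) *s V" by (simp add: X vec_eq_iff algebra_simps)
    then have "H (c *s X) (c *s X) = H ((c * \<zeta>) *s V) ((c * \<zeta>) *s V)"
      using Tsc[OF VT] Tsc[OF AT] by (simp only: Ha ker add_0)
    then show "H (c *s X) (c *s X) < 0"
      using V c \<open>\<zeta> \<noteq> 0\<close> unfolding neg_line_def by (metis mult_eq_0_iff)
  qed

  \<comment> \<open>The line and the sections through it\<close>
  define l where "l = (\<lambda>x. p + x) ` vec.span {A}"
  have mem_l: "b \<in> l \<longleftrightarrow> (\<exists>t. b = p + t *s A)" for b
    by (auto simp: l_def vec.span_singleton)
  have line: "complex_line l"
    unfolding complex_affine_def
    by (intro exI[of _ p] exI[of _ "vec.span {A}"]) (simp add: l_def dim_span_singleton A0)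
  have "p \<in> l" unfolding mem_l by (intro exI[of _ 0]) simp
  have near: "\<exists>t \<zeta>. z = p + t *s A + \<zeta> *s V \<and> cmod t \<le> \<delta> \<and> cmod \<zeta> \<le> \<delta>"
    if zb: "z \<in> ball p (\<beta> * \<delta>)" and zT: "z - p \<in> T" for z
  proof -
    obtain t \<zeta> where z: "z - p = t *s A + \<zeta> *s V" using T_eq[OF zT] by blast
    have "\<beta> * norm (t, \<zeta>) < \<beta> * \<delta>"
      using \<beta>(2)[of "(t, \<zeta>)"] zb z[symmetric] by (simp add: dist_norm norm_minus_commute[of p])
    then have "norm (t, \<zeta>) < \<delta>" using \<beta>(1) by simp
    then have "cmod t \<le> \<delta>" "cmod \<zeta> \<le> \<delta>"
      using norm_fst_le[of t \<zeta>] norm_snd_le[of \<zeta> t] by auto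
    then show ?thesis using z by (intro exI[of _ t] exI[of _ \<zeta>]) (auto simp: algebra_simps)
  qed
  have "open (ball p (\<beta> * \<delta>))" "p \<in> ball p (\<beta> * \<delta>)" using \<beta>(1) \<delta> by auto
  note ball = this
  have i1: "subset_near p (tangent_hyperplane r p - l) D"
    unfolding subset_near_def
  proof (intro exI[of _ "ball p (\<beta> * \<delta>)"] conjI ball subsetI)
    fix z assume z: "z \<in> (tangent_hyperplane r p - l) \<inter> ball p (\<beta> * \<delta>)"
    then obtain t \<zeta> where tz: "z = p + t *s A + \<zeta> *s V" "cmod t \<le> \<delta>" "cmod \<zeta> \<le> \<delta>"
      using near tangent_hyperplane_iff by blast
    then have "\<zeta> \<noteq> 0" using z mem_l by auto
    then have "r z < 0" using le0[OF tz(2,3)] eq0[OF tz(2,3)] tz(1) by simp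
    then show "z \<in> D" using mem_D_iff inU[OF tz(2,3)] tz(1) by simp
  qed
  have i2: "subset_near p l (frontier D)"
    unfolding subset_near_def
  proof (intro exI[of _ "ball p (\<beta> * \<delta>)"] conjI ball subsetI)
    fix z assume z: "z \<in> l \<inter> ball p (\<beta> * \<delta>)"
    then obtain s where s: "z = p + s *s A" using mem_l by blast
    then have "z - p \<in> T" using Tsc[OF AT] by simp
    then obtain t \<zeta> where tz: "z = p + t *s A + \<zeta> *s V" "cmod t \<le> \<delta>" "cmod \<zeta> \<le> \<delta>"
      using near z by blast
    have "(t - s) *s A + \<zeta> *s V = 0" using s tz(1) by (simp add: vec_eq_iff algebra_simps)
    then have "\<zeta> = 0" using ind unfolding cindep_def by blast
    then show "z \<in> frontier D"
      using mem_frontier_iff[OF inU[OF tz(2,3)]] eq0[OF tz(2,3)] tz(1) by simp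
  qed
  \<comment> \<open>If \<open>b\<close> is tangent but off the line, then \<open>b - p\<close> takes
    over the role of \<open>V\<close>; in the other cases \<open>V\<close> itself serves.\<close>
  have through: "\<exists>P. complex_plane P \<and> p \<in> P \<and> b \<in> P \<and> \<not> pseudoconvex_in P (P \<inter> D)"
    if "b \<notin> l \<or> b = p" for b
  proof -
    consider "b = p" | "b - p \<notin> T" | "b - p \<in> T" "b \<notin> l" using \<open>b \<notin> l \<or> b = p\<close> by blast
    then show ?thesis
    proof cases
      case 1
      then have "b - p \<notin> T \<or> b - p = 0 *s V" by simp
      then show ?thesis by (metis nonpseudoconvex_section_through[OF V])
    next
      case 2
      then have "b - p \<notin> T \<or> b - p = 0 *s V" by simp
      then show ?thesis by (metis nonpseudoconvex_section_through[OF V])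
    next
      case 3
      have "b - p \<noteq> t *s A" for t
      proof
        assume "b - p = t *s A"
        then have "b = p + t *s A" by (simp add: algebra_simps)
        then show False using 3 mem_l by blast
      qed
      then have "neg_line (b - p)" using 3 neg by blast
      moreover have "b - p \<notin> T \<or> b - p = 1 *s (b - p)" by simp
      ultimately show ?thesis by (metis nonpseudoconvex_section_through)
    qed
  qed
  have notl: "\<not> (\<exists>P. complex_plane P \<and> p \<in> P \<and> b \<in> P \<and> \<not> pseudoconvex_in P (P \<inter> D))"
    if "b \<in> l" "b \<noteq> p" for b
  proof
    assume "\<exists>P. complex_plane P \<and> p \<in> P \<and> b \<in> P \<and> \<not> pseudoconvex_in P (P \<inter> D)"
    then obtain P where P: "complex_plane P" "p \<in> P" "b \<in> P" "\<not> pseudoconvex_in P (P \<inter> D)" by blast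
    obtain q W where W: "vec.subspace W" "P = (\<lambda>x. q + x) ` W"
      using P(1) unfolding complex_affine_def by blast
    obtain t where t: "b = p + t *s A" using \<open>b \<in> l\<close> mem_l by blast
    then have "t \<noteq> 0" using \<open>b \<noteq> p\<close> by auto
    obtain w1 w2 where w: "w1 \<in> W" "w2 \<in> W" "p = q + w1" "b = q + w2" using P W by auto
    have "w2 - w1 = t *s A" using w t by (simp add: algebra_simps)
    then have "A = (1 / t) *s (w2 - w1)" using \<open>t \<noteq> 0\<close> by simp
    then have "A \<in> W" using w W by (metis vec.subspace_diff vec.subspace_scale)
    then have "w1 + A \<in> W" using w W by (metis vec.subspace_add)
    moreover have "a = q + (w1 + A)" using w by (simp add: A_def)
    ultimately have "a \<in> P" using W by blast
    then show False using P a unfolding nonpsc_section_set_def by blast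
  qed
  have vanish: "H X X = 0 \<and> levi_form r p X X = 0" if Xl: "p + X \<in> l" for X
  proof -
    obtain t where "p + X = p + t *s A" using Xl mem_l by blast
    then have X: "X = t *s A" by simp
    have "\<i> *s X = (\<i> * t) *s A" by (simp add: X vec_eq_iff)
    then show ?thesis
      using H_A[of t] H_A[of "\<i> * t"] sym[of X "\<i> *s X"] by (simp add: levi_form_eq[OF twice] X)
  qed

  \<comment> \<open>Eigenvalues of the Levi form\<close>
  define hp where "hp X Y = (\<Sum>j\<in>UNIV. X $ j * cnj (Y $ j))" for X Y :: "complex^'n"
  have hp_add: "hp (X + X') Y = hp X Y + hp X' Y" "hp Y (X + X') = hp Y X + hp Y X'"
    and hp_sc: "hp (c *s X) Y = c * hp X Y" "hp X (c *s Y) = cnj c * hp X Y" for X X' Y c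
    by (simp_all add: hp_def sum.distrib sum_distrib_left algebra_simps)
  have hp_cnj: "hp Y X = cnj (hp X Y)" for X Y by (simp add: hp_def mult.commute)
  have hp_norm: "hp X X = of_real ((norm X)\<^sup>2)" for X unfolding hp_def by (rule hermitian_norm)
  have hpA: "hp A A \<noteq> 0" using A0 by (simp add: hp_norm)
  \<comment> \<open>Gram-Schmidt coefficient: \<open>f\<close> is the part of \<open>V\<close> that
    is Hermitian orthogonal to \<open>A\<close>. The orthogonal basis \<open>A\<close>,
    \<open>f\<close> of \<open>T\<close> will diagonalise the Levi form.\<close>
  define c where "c = hp V A / hp A A"
  define f where "f = V + (- c) *s A"
  have Vf: "V = f + c *s A" by (simp add: f_def vec_eq_iff)
  have fT: "f \<in> T" unfolding f_def by (intro Tad Tsc VT AT)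
  have fA: "hp f A = 0" "hp A f = 0"
  proof -
    show "hp f A = 0" using hpA unfolding f_def hp_add hp_sc c_def by simp
    then show "hp A f = 0" using hp_cnj[of A f] by simp
  qed
  have f_notA: "f \<noteq> t *s A" for t
  proof
    assume "f = t *s A"
    then have "(t + c) *s A + (- 1) *s V = 0" by (simp add: Vf vec_eq_iff algebra_simps)
    then show False using ind unfolding cindep_def by (metis neg_equal_0_iff_equal one_neq_zero)
  qed
  then have f_neg: "neg_line f" by (intro neg fT)
  have f0: "f \<noteq> 0" by (rule neg_line_nonzero[OF f_neg])
  then have hpf: "hp f f \<noteq> 0" by (simp add: hp_norm)
  have T_eq': "\<exists>\<alpha> \<beta>. X = \<alpha> *s A + \<beta> *s f" if XT: "X \<in> T" for X
  proof -
    obtain t \<zeta> where X: "X = t *s A + \<zeta> *s V" using T_eq[OF XT] by blast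
    have "X = (t + \<zeta> * c) *s A + \<zeta> *s f" by (simp add: X Vf vec_eq_iff algebra_simps)
    then show ?thesis by blast
  qed
  \<comment> \<open>\<open>\<nu>\<close> is the Rayleigh quotient of the Levi form at
    \<open>f\<close>; it is negative because \<open>f\<close> spans a negative line, which also
    contains \<open>\<i> *s f\<close>.\<close>
  define \<nu> where "\<nu> = (H f f + H (\<i> *s f) (\<i> *s f)) / 4 / (norm f)\<^sup>2"
  have "H (1 *s f) (1 *s f) < 0" "H (\<i> *s f) (\<i> *s f) < 0"
    using f_neg unfolding neg_line_def by (metis zero_neq_one, metis complex_i_not_zero)
  then have \<nu>: "\<nu> < 0" using f0 by (simp add: \<nu>_def divide_neg_pos)
  have Lf: "levi_form r p f f = of_real \<nu> * hp f f"
    using f0 sym[of "\<i> *s f" f] by (simp add: levi_form_eq[OF twice] hp_norm \<nu>_def)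
  \<comment> \<open>All complex multiples of \<open>A\<close> lie in the kernel of the Hessian, so
    the Levi form sees only the coefficients of \<open>f\<close>.\<close>
  have L: "levi_form r p (\<alpha> *s A + \<beta> *s f) (\<gamma> *s A + \<eta> *s f) = \<beta> * cnj \<eta> * (of_real \<nu> * hp f f)" for \<alpha> \<beta> \<gamma> \<eta>
  proof -
    have HH: "H (\<alpha> *s A + \<beta> *s f) (\<gamma> *s A + \<eta> *s f) = H (\<beta> *s f) (\<eta> *s f)" for \<alpha> \<beta> \<gamma> \<eta>
      using Tsc[OF fT] Tsc[OF AT] by (simp only: Ha ker add_0)
    have ia: "\<i> *s (\<alpha> *s A + \<beta> *s f) = (\<i> * \<alpha>) *s A + (\<i> * \<beta>) *s f" for \<alpha> \<beta>
      by (simp add: vec_eq_iff algebra_simps)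
    have ib: "\<i> *s (\<beta> *s f) = (\<i> * \<beta>) *s f" for \<beta> by (simp add: vec_eq_iff)
    have "levi_form r p (\<alpha> *s A + \<beta> *s f) (\<gamma> *s A + \<eta> *s f) = levi_form r p (\<beta> *s f) (\<eta> *s f)"
      unfolding levi_form_eq[OF twice] ia ib HH by (rule refl)
    then show ?thesis by (simp add: levi_form_smult Lf)
  qed
  \<comment> \<open>Testing the eigenvalue equation against \<open>A\<close> and against
    \<open>f\<close> gives one scalar equation for each coordinate.\<close>
  have eigset: "{X \<in> T. \<forall>Y\<in>T. levi_form r p X Y = of_real \<mu> * hp X Y} =
      {\<alpha> *s A + \<beta> *s f |\<alpha> \<beta>. of_real \<mu> * \<alpha> = 0 \<and> (of_real \<mu> - of_real \<nu>) * \<beta> = 0}" for \<mu> :: real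
  proof (intro set_eqI iffI)
    fix X assume X: "X \<in> {X \<in> T. \<forall>Y\<in>T. levi_form r p X Y = of_real \<mu> * hp X Y}"
    then obtain \<alpha> \<beta> where ab: "X = \<alpha> *s A + \<beta> *s f" using T_eq' by blast
    have "levi_form r p X (1 *s A + 0 *s f) = of_real \<mu> * hp X (1 *s A + 0 *s f)"
      using X by (blast intro: Tad Tsc AT fT)
    then have 1: "\<mu> * \<alpha> = 0"
      unfolding ab L using hpA by (simp add: hp_add hp_sc fA)
    have "levi_form r p X (0 *s A + 1 *s f) = of_real \<mu> * hp X (0 *s A + 1 *s f)"
      using X by (blast intro: Tad Tsc AT fT)
    then have "\<beta> * \<nu> = \<mu> * \<beta>"
      unfolding ab L using hpf by (simp add: hp_add hp_sc fA)
    then have "(of_real \<mu> - of_real \<nu>) * \<beta> = 0" by auto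
    then show "X \<in> {\<alpha> *s A + \<beta> *s f |\<alpha> \<beta>. of_real \<mu> * \<alpha> = 0 \<and> (of_real \<mu> - of_real \<nu>) * \<beta> = 0}"
      using ab 1 by blast
  next
    fix X assume "X \<in> {\<alpha> *s A + \<beta> *s f |\<alpha> \<beta>. of_real \<mu> * \<alpha> = 0 \<and> (of_real \<mu> - of_real \<nu>) * \<beta> = 0}"
    then obtain \<alpha> \<beta> where ab: "X = \<alpha> *s A + \<beta> *s f" "of_real \<mu> * \<alpha> = 0" "(of_real \<mu> - of_real \<nu>) * \<beta> = 0" by blast
    have "levi_form r p X Y = of_real \<mu> * hp X Y" if YT: "Y \<in> T" for Y
    proof -
      obtain \<gamma> \<eta> where Y: "Y = \<gamma> *s A + \<eta> *s f" using T_eq'[OF YT] by blast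
      have "of_real \<mu> * hp X Y = (\<mu> * \<alpha>) * (cnj \<gamma> * hp A A) + (\<mu> * \<beta>) * (cnj \<eta> * hp f f)"
        unfolding ab(1) Y hp_add hp_sc fA by (simp add: algebra_simps)
      moreover have "\<mu> * \<beta> = \<nu> * \<beta>" using ab(3) by (simp add: algebra_simps)
      ultimately have "of_real \<mu> * hp X Y = (\<nu> * \<beta>) * (cnj \<eta> * hp f f)" using ab(2) by simp
      then show ?thesis unfolding ab(1) Y L by (simp add: ac_simps)
    qed
    then show "X \<in> {X \<in> T. \<forall>Y\<in>T. levi_form r p X Y = of_real \<mu> * hp X Y}"
      using ab(1) AT fT by (auto intro: Tad Tsc)
  qed
  have hermitian: "hermitian_eigenvalues_on T (levi_form r p) {#\<nu>, 0#}"
    unfolding hermitian_eigenvalues_on_def hp_def[symmetric] eigset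
  proof
    fix \<mu> :: real
    let ?E = "{\<alpha> *s A + \<beta> *s f |\<alpha> \<beta>. of_real \<mu> * \<alpha> = 0 \<and> (complex_of_real \<mu> - of_real \<nu>) * \<beta> = 0}"
    consider "\<mu> = \<nu>" | "\<mu> = 0" | "\<mu> \<noteq> \<nu>" "\<mu> \<noteq> 0" by blast
    then show "count {#\<nu>, 0#} \<mu> = vec.dim ?E"
    proof cases
      case 1
      then have "?E = vec.span {f}" using \<nu> by (auto simp: vec.span_singleton)
      then show ?thesis using 1 \<nu> f0 by (simp add: dim_span_singleton)
    next
      case 2
      then have "?E = vec.span {A}" using \<nu> by (auto simp: vec.span_singleton)
      then show ?thesis using 2 \<nu> A0 by (simp add: dim_span_singleton)
    next
      case 3
      then have "?E = vec.span {0}" by (auto simp: vec.span_singleton)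
      then show ?thesis using 3 by (simp add: dim_span_singleton)
    qed
  qed
  have "eigenvalues_on T H {#\<kappa>1, \<kappa>2, 0, 0#}" using eig k3 k4 by simp
  moreover have "UNIV - l \<subseteq> nonpsc_section_set D" "p \<in> nonpsc_section_set D"
    using through unfolding nonpsc_section_set_def by blast+
  ultimately show ?thesis
    using line \<open>p \<in> l\<close> i1 i2 through notl vanish \<kappa>(1,2) \<nu> hermitian by (intro exI[of _ l]) blast
qed

end

theorem theorem2:
  fixes D U :: "(complex^3) set" and p :: "complex^3" and r :: "complex^3 \<Rightarrow> real"
    and \<kappa>1 \<kappa>2 \<kappa>3 \<kappa>4 :: real
  assumes "open D" and "p \<in> frontier D"
    and "defining_function D p U r" and "C1_on U r"
    and "\<exists>X. frechet_derivative r (at p) X \<noteq> 0"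
    and "twice_differentiable_at r p"
    and "eigenvalues_on (tangent_directions r p) (hessian r p) {#\<kappa>1, \<kappa>2, \<kappa>3, \<kappa>4#}"
    and "\<kappa>1 < 0" and "\<kappa>2 < 0" and "\<kappa>3 \<le> 0"
    and "nonpsc_section_set D \<noteq> UNIV"
  shows "\<exists>l. complex_line l \<and> p \<in> l \<and>
    (subset_near p (tangent_hyperplane r p - l) D \<and>
     subset_near p l (frontier D) \<and>
     UNIV - l \<subseteq> nonpsc_section_set D) \<and>
    ((\<forall>b. b \<notin> l \<or> b = p \<longrightarrow>
        (\<exists>P. complex_plane P \<and> p \<in> P \<and> b \<in> P \<and> \<not> pseudoconvex_in P (P \<inter> D))) \<and>
     p \<in> nonpsc_section_set D \<and>
     (\<forall>b. b \<in> l \<and> b \<noteq> p \<longrightarrow>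
        \<not> (\<exists>P. complex_plane P \<and> p \<in> P \<and> b \<in> P \<and> \<not> pseudoconvex_in P (P \<inter> D)))) \<and>
    ((\<forall>X. p + X \<in> l \<longrightarrow> hessian r p X X = 0 \<and> levi_form r p X X = 0) \<and>
     (\<exists>\<mu>1 \<mu>2. \<mu>1 < 0 \<and> \<mu>2 < 0 \<and>
        eigenvalues_on (tangent_directions r p) (hessian r p) {#\<mu>1, \<mu>2, 0, 0#}) \<and>
     (\<exists>\<nu>. \<nu> < 0 \<and>
        hermitian_eigenvalues_on (tangent_directions r p) (levi_form r p) {#\<nu>, 0#}))"
proof -
  interpret boundary_point D U p r using assms(2-6) by unfold_locales
  \<comment> \<open>The ambient real dimension is 6, and \<open>dim_T\<close> removes two real
    directions.\<close>
  have "dim (tangent_directions r p) \<le> 4" using dim_T by simp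
  then show ?thesis by (rule nonpsc_sections[OF _ assms(7-11)])
qed

end
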